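(* Consider the problem of minimizing $P_1$ over $C\cap\mathscr{F}$ in the convex setting described in the context (so $P_2=0$, each $g_i$ is convex, and the Slater condition holds). Let $\{(x^k,\theta_k)\}$ be generated by Algorithm ESQM$_{\rm e}$ (described in the context), and let $\hat m:=\inf\{P_1(x):x\in C\}$. Then the following statements hold. (i) For any $k\ge 1$, $$E(x^{k+1},x^k,\theta_{k+1})\le E(x^k,x^{k-1},\theta_k)-\frac{(1-\beta_k^2)L_g}{2}\|x^k-x^{k-1}\|^2,$$ where $E(x,y,\theta):=\frac1\theta\left(P_1(x)-\hat m+\delta_C(x)+\theta\max_{i=1,\ldots,m}[g_i(x)]_+ +\frac{\theta L_g}{2}\|x-y\|^2\right)$. (ii) Let $\Omega$ be the set of accumulation points of $\{(x^{k+1},x^k,\theta_k)\}$. Then $\Omega$ is a nonempty compact set, $\bar\omega:=\lim_{k\to\infty}E(x^{k+1},x^k,\theta_k)$ exists, and $E\equiv\bar\omega$ on $\Omega$. (iii) Let $\hat\theta$ be the eventual constant value of $\{\theta_k\}$ (see the context). If the function $$F_{\hat\theta}(x):=\frac{1}{\hat\theta}(P_1(x)-\hat m)+\delta_C(x)+\max_{i=1,\ldots,m}[g_i(x)]_+$$ is a KL function with exponent $\frac12$, then $\{x^k\}$ converges to a minimizer $x^*$ of the problem, and there exist $c_0>0$, $s\in(0,1)$ and $k_0\in\mathbb{N}$ such that $\|x^k-x^*\|\le c_0s^k$ for all $k>k_0$.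
   Context: Problem (convex setting). $P_1:\mathbb{R}^n\to\mathbb{R}$ is convex; $g_1,\ldots,g_m:\mathbb{R}^n\to\mathbb{R}$ are convex and differentiable with Lipschitz continuous gradients; $C\subseteq\mathbb{R}^n$ is a nonempty compact convex set; $\mathscr{F}:=\{x\in\mathbb{R}^n:g_i(x)\le 0,\ i=1,\ldots,m\}$. The Slater condition holds: there exists $\hat x\in C$ with $g_i(\hat x)<0$ for $i=1,\ldots,m$. The problem is $\min\{P_1(x):x\in C\cap\mathscr{F}\}$. Constants. $L_{g_i}>0$ is a Lipschitz modulus of $\nabla g_i$ and $L_g:=\max_{i=1,\ldots,m}L_{g_i}$. (In the general algorithm $g_i$ is written as a difference of two convex functions with moduli $L_{g_i}$ and $\ell_{g_i}$ for the gradients; in the present convex setting $\ell_{g_i}=0$ for all $i$, so the threshold on $\beta_k$ is $1$.) Notation. $[t]_+:=\max\{t,0\}$ for $t\in\mathbb{R}$; $\|\cdot\|$ is the Euclidean norm; ${\rm lin}_{g_i}(u,w):=g_i(w)+\langle\nabla g_i(w),u-w\rangle$; $\delta_C$ is the indicator function of $C$ ($0$ on $C$, $\infty$ off $C$); ${\rm dist}(x,D)$ is the Euclidean distance from $x$ to $D$. Algorithm ESQM$_{\rm e}$. Choose $x^{-1}=x^0\in C$, $\theta_0>0$, $d>0$ and $\{\beta_k\}\subseteq[0,1)$ with $\bar\beta:=\sup_k\beta_k<1$. For $k=0,1,2,\ldots$: (1) set $y^k=x^k+\beta_k(x^k-x^{k-1})$; (2) let $(x^{k+1},s^{k+1})$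 be a minimizer over $(x,s)\in C\times\mathbb{R}_+$ of $P_1(x)+\theta_k s+\frac{\theta_kL_g}{2}\|x-y^k\|^2$ subject to ${\rm lin}_{g_i}(x,y^k)\le s$ for $i=1,\ldots,m$; (3) if ${\rm lin}_{g_i}(x^{k+1},y^k)\le 0$ for all $i=1,\ldots,m$, set $\theta_{k+1}=\theta_k$; otherwise set $\theta_{k+1}=\theta_k+d$. Eventual penalty parameter. In this setting there exists $N_0\in\mathbb{N}$ such that $\theta_k=\theta_{N_0}$ for all $k\ge N_0$; set $\hat\theta:=\theta_{N_0}$. KL function with exponent. A proper closed (lower semicontinuous) function $f:\mathbb{R}^n\to(-\infty,+\infty]$ satisfies the KL property with exponent $\alpha\in[0,1)$ at $\bar x\in{\rm dom}\,\partial f:=\{x:\partial f(x)\ne\emptyset\}$ if there exist $r\in(0,\infty]$, a neighborhood $U$ of $\bar x$ and $\rho>0$ such that, with $\phi(\varsigma)=\rho\varsigma^{1-\alpha}$, $\phi'(f(x)-f(\bar x))\,{\rm dist}(0,\partial f(x))\ge 1$ for all $x\in U$ with $f(\bar x)<f(x)<f(\bar x)+r$. Here $\partial f$ is the limiting subdifferential, which is the usual convex subdifferential when $f$ is convex. $f$ is a KL function with exponent $\alpha$ if this holds at every point of ${\rm dom}\,\partial f$. *)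

theory Defs
  imports "HOL-Analysis.Analysis"
begin

section \<open>Extended-real-valued functions, subdifferentials and the KL property\<close>

definition delta :: "'a set \<Rightarrow> 'a \<Rightarrow> ereal" where
  "delta C x = (if x \<in> C then 0 else \<infinity>)"

definition proper :: "('a \<Rightarrow> ereal) \<Rightarrow> bool" where
  "proper f \<longleftrightarrow> (\<forall>x. f x \<noteq> -\<infinity>) \<and> (\<exists>x. f x \<noteq> \<infinity>)"

definition lsc :: "('a::topological_space \<Rightarrow> ereal) \<Rightarrow> bool" where
  "lsc f \<longleftrightarrow> (\<forall>x. f x \<le> Liminf (at x) f)"

definition regular_subdiff :: "('a::real_inner \<Rightarrow> ereal) \<Rightarrow> 'a \<Rightarrow> 'a set" where
  "regular_subdiff f x = {v. \<bar>f x\<bar> \<noteq> \<infinity> \<and>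
     0 \<le> Liminf (at x) (\<lambda>z. (f z - f x - ereal (v \<bullet> (z - x))) / ereal (norm (z - x)))}"

definition limiting_subdiff :: "('a::real_inner \<Rightarrow> ereal) \<Rightarrow> 'a \<Rightarrow> 'a set" where
  "limiting_subdiff f x = {v. \<bar>f x\<bar> \<noteq> \<infinity> \<and>
     (\<exists>X V. X \<longlonglongrightarrow> x \<and> (\<lambda>j. f (X j)) \<longlonglongrightarrow> f x \<and>
            (\<forall>j. V j \<in> regular_subdiff f (X j)) \<and> V \<longlonglongrightarrow> v)}"

text \<open>Unlike \<^const>\<open>infdist\<close>, this distance to the empty set is \<open>\<infinity>\<close>, so that the
  inequality in the KL property holds trivially at points without subgradients.\<close>
definition edist_to :: "'a::metric_space \<Rightarrow> 'a set \<Rightarrow> ereal" where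
  "edist_to x D = (INF v\<in>D. ereal (dist x v))"

definition kl_at :: "('a::real_inner \<Rightarrow> ereal) \<Rightarrow> real \<Rightarrow> 'a \<Rightarrow> bool" where
  "kl_at f \<alpha> xbar \<longleftrightarrow>
     (\<exists>(r::ereal) U (\<rho>::real). 0 < r \<and> open U \<and> xbar \<in> U \<and> 0 < \<rho> \<and>
        (\<forall>x\<in>U. f xbar < f x \<and> f x < f xbar + r \<longrightarrow>
           1 \<le> ereal (deriv (\<lambda>t. \<rho> * t powr (1 - \<alpha>)) (real_of_ereal (f x - f xbar)))
               * edist_to 0 (limiting_subdiff f x)))"

definition kl_function :: "('a::real_inner \<Rightarrow> ereal) \<Rightarrow> real \<Rightarrow> bool" where
  "kl_function f \<alpha> \<longleftrightarrow> proper f \<and> lsc f \<and> 0 \<le> \<alpha> \<and> \<alpha> < 1 \<and>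
     (\<forall>x. limiting_subdiff f x \<noteq> {} \<longrightarrow> kl_at f \<alpha> x)"


section \<open>The problem and the algorithm\<close>

text \<open>The constraints are \<open>g 1, \<dots>, g m\<close>; \<open>G i\<close> is the gradient of \<open>g i\<close>.\<close>

definition feasible_set :: "nat \<Rightarrow> (nat \<Rightarrow> 'a \<Rightarrow> real) \<Rightarrow> 'a set" where
  "feasible_set m g = {x. \<forall>i\<in>{1..m}. g i x \<le> 0}"

definition lin :: "('a::real_inner \<Rightarrow> real) \<Rightarrow> ('a \<Rightarrow> 'a) \<Rightarrow> 'a \<Rightarrow> 'a \<Rightarrow> real" where
  "lin h Dh u w = h w + Dh w \<bullet> (u - w)"

definition max_violation :: "nat \<Rightarrow> (nat \<Rightarrow> 'a \<Rightarrow> real) \<Rightarrow> 'a \<Rightarrow> real" where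
  "max_violation m g x = Max ((\<lambda>i. max (g i x) 0) ` {1..m})"

text \<open>The convention \<open>x\<^sup>-\<^sup>1 = x\<^sup>0\<close> is realised by truncated subtraction:
  at \<open>k = 0\<close> the term \<open>x (k - 1)\<close> is \<open>x 0\<close>.\<close>
definition extrapolation :: "(nat \<Rightarrow> real) \<Rightarrow> (nat \<Rightarrow> 'a::real_vector) \<Rightarrow> nat \<Rightarrow> 'a" where
  "extrapolation \<beta> x k = x k + \<beta> k *\<^sub>R (x k - x (k - 1))"

definition esqm_e ::
  "('a::real_inner \<Rightarrow> real) \<Rightarrow> nat \<Rightarrow> (nat \<Rightarrow> 'a \<Rightarrow> real) \<Rightarrow> (nat \<Rightarrow> 'a \<Rightarrow> 'a) \<Rightarrow> 'a set \<Rightarrow> real \<Rightarrow>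
   real \<Rightarrow> (nat \<Rightarrow> real) \<Rightarrow> (nat \<Rightarrow> 'a) \<Rightarrow> (nat \<Rightarrow> real) \<Rightarrow> (nat \<Rightarrow> real) \<Rightarrow> bool" where
  "esqm_e P m g G C Lg d \<beta> x s \<theta> \<longleftrightarrow>
     x 0 \<in> C \<and> 0 < \<theta> 0 \<and> 0 < d \<and> (\<forall>k. 0 \<le> \<beta> k \<and> \<beta> k < 1) \<and> (SUP k. \<beta> k) < 1 \<and>
     (\<forall>k. let y = extrapolation \<beta> x k in
        is_arg_min
          (\<lambda>(u, t). P u + \<theta> k * t + \<theta> k * Lg / 2 * (norm (u - y))\<^sup>2)
          (\<lambda>(u, t). u \<in> C \<and> 0 \<le> t \<and> (\<forall>i\<in>{1..m}. lin (g i) (G i) u y \<le> t))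
          (x (Suc k), s (Suc k)) \<and>
        \<theta> (Suc k) = (if \<forall>i\<in>{1..m}. lin (g i) (G i) (x (Suc k)) y \<le> 0 then \<theta> k else \<theta> k + d))"

text \<open>In the next two definitions \<open>mhat\<close> stands for the infimum of \<open>P\<close> over \<open>C\<close>.\<close>

definition potential ::
  "('a::real_normed_vector \<Rightarrow> real) \<Rightarrow> nat \<Rightarrow> (nat \<Rightarrow> 'a \<Rightarrow> real) \<Rightarrow> 'a set \<Rightarrow> real \<Rightarrow> real \<Rightarrow>
   'a \<Rightarrow> 'a \<Rightarrow> real \<Rightarrow> ereal" where
  "potential P m g C Lg mhat x y \<theta> =
     ereal (1 / \<theta>) * (ereal (P x - mhat) + delta C x + ereal (\<theta> * max_violation m g x)
                       + ereal (\<theta> * Lg / 2 * (norm (x - y))\<^sup>2))"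

definition penalty_fun ::
  "('a \<Rightarrow> real) \<Rightarrow> nat \<Rightarrow> (nat \<Rightarrow> 'a \<Rightarrow> real) \<Rightarrow> 'a set \<Rightarrow> real \<Rightarrow> real \<Rightarrow> 'a \<Rightarrow> ereal" where
  "penalty_fun P m g C mhat \<theta> x =
     ereal (1 / \<theta> * (P x - mhat)) + delta C x + ereal (max_violation m g x)"

text \<open>Accumulation points of a sequence, i.e. limits of its subsequences (not limit points of
  its range: a constant sequence has an accumulation point).\<close>
definition accumulation_points :: "(nat \<Rightarrow> 'a::topological_space) \<Rightarrow> 'a set" where
  "accumulation_points z = {p. \<exists>r::nat \<Rightarrow> nat. strict_mono r \<and> (z \<circ> r) \<longlonglongrightarrow> p}"

end

theory Submission
  imports Defs
begin

text \<open>
  Write \<open>F\<^sub>k(u) = (P(u) - mhat)/\<theta>\<^sub>k + max\<^sub>i [g\<^sub>i(u)]\<^sub>+\<close> and let \<open>y\<^sub>k\<close> be the extrapolated point. After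
  elimination of the slack, \<open>x\<^sub>k\<^sub>+\<^sub>1\<close> minimizes over \<open>C\<close> a strongly convex model of \<open>F\<^sub>k\<close>: linearizing
  the constraints only lowers the violation (convexity), and by at most \<open>Lg/2 \<parallel>u - y\<^sub>k\<parallel>\<^sup>2\<close> (Lipschitz
  gradients), which is exactly the proximal term. So the method obeys the inequality of an
  extrapolated proximal gradient method,
  \<open>F\<^sub>k(x\<^sub>k\<^sub>+\<^sub>1) + Lg/2 \<parallel>u - x\<^sub>k\<^sub>+\<^sub>1\<parallel>\<^sup>2 \<le> F\<^sub>k(u) + Lg/2 \<parallel>u - y\<^sub>k\<parallel>\<^sup>2\<close> for all \<open>u \<in> C\<close>
  (\<open>pen_three_point\<close>), and most of the analysis consists of choices of \<open>u\<close>.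

  With \<open>u = x\<^sub>k\<close> it is the descent of the potential, since \<open>F\<close> decreases in \<open>\<theta>\<close>. The potential is
  nonnegative, hence it converges and the steps tend to zero. If steps are small and \<open>\<theta>\<^sub>k\<close> is large,
  a minimizer of the model violating the linearized constraints could be improved by moving it towards
  the Slater point (\<open>penalty_increase_bound\<close>), so no further increase
  occurs. Hence \<open>\<theta>\<^sub>k\<close> is eventually constant, and compactness of \<open>C\<close> and continuity describe the
  accumulation points.

  With \<open>u\<close> a minimizer of \<open>F\<close> over \<open>C\<close>, the limit of the potential is the minimum \<open>\<mu>\<close> of \<open>F\<close>
  (\<open>energy_tendsto_min\<close>). With \<open>u = p\<close>, the proximal point of \<open>x\<^sub>k\<^sub>+\<^sub>1\<close>, the distance from \<open>x\<^sub>k\<^sub>+\<^sub>1\<close> to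
  \<open>p\<close> is at most twice \<open>\<parallel>x\<^sub>k\<^sub>+\<^sub>1 - y\<^sub>k\<parallel>\<close>. The KL inequality at \<open>p\<close>, made uniform by compactness
  (\<open>kl_half_uniform\<close>), then bounds \<open>F(x\<^sub>k\<^sub>+\<^sub>1) - \<mu>\<close> by a multiple of \<open>\<parallel>x\<^sub>k\<^sub>+\<^sub>1 - y\<^sub>k\<parallel>\<^sup>2\<close>
  (\<open>pen_gap_le_of_subgradient_bound\<close>), that is, by the last two squared steps, which are in turn
  bounded by decrements of the potential. Hence the gap of the potential contracts geometrically, and so do the
  steps. The limit of the iterates is feasible because eventually the linearized constraints hold
  in every step, and a feasible minimizer of the penalty function solves the problem.
\<close>

section \<open>Minimizers of a convex function plus a quadratic\<close>

lemma nonneg_if_perturbations_nonneg: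
  fixes a b :: real
  assumes "\<And>t. 0 < t \<Longrightarrow> t < 1 \<Longrightarrow> 0 \<le> a + t * b"
  shows "0 \<le> a"
proof (rule tendsto_lowerbound)
  show "((\<lambda>t. a + t * b) \<longlongrightarrow> a) (at_right 0)"
    by (auto intro!: tendsto_eq_intros)
  show "\<forall>\<^sub>F t in at_right 0. 0 \<le> a + t * b"
    using assms by (auto simp: eventually_at_right_field intro!: exI[of _ 1])
qed simp

text \<open>The first-order condition for minimizing \<open>h + c/2 \<parallel>\<cdot> - y\<parallel>\<^sup>2\<close> over \<open>C\<close>: the proximal residual
  \<open>c (y - z)\<close> is a subgradient of \<open>h\<close> at the minimizer, relative to \<open>C\<close>. It
  follows from minimality along the segment from \<open>z\<close> to \<open>u\<close>.\<close>
lemma minimizer_plus_quadratic_subgradient: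
  fixes h :: "'a::real_inner \<Rightarrow> real"
  assumes h: "convex_on C h" and z: "z \<in> C" and u: "u \<in> C"
    and min: "\<And>w. w \<in> C \<Longrightarrow> h z + c / 2 * (norm (z - y))\<^sup>2 \<le> h w + c / 2 * (norm (w - y))\<^sup>2"
  shows "h z + c * ((y - z) \<bullet> (u - z)) \<le> h u"
proof -
  \<comment> \<open>Comparing \<open>z\<close> with a point at distance of order \<open>t\<close> makes the square a second-order term;
    dividing by \<open>t\<close> leaves a perturbation that vanishes with \<open>t\<close>.\<close>
  have "0 \<le> (h u - h z - c * ((y - z) \<bullet> (u - z))) + t * (c / 2 * (norm (u - z))\<^sup>2)"
    if t: "0 < t" "t < 1" for t
  proof -
    define w where "w = (1 - t) *\<^sub>R z + t *\<^sub>R u"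
    have "w \<in> C"
      using convex_on_imp_convex[OF h] z u t unfolding w_def
      by (intro convexD) auto
    have hw: "h w \<le> (1 - t) * h z + t * h u"
      unfolding w_def using convex_onD[OF h, of t z u] z u t by auto
    have wy: "w - y = (z - y) + t *\<^sub>R (u - z)"
      unfolding w_def by (simp add: algebra_simps)
    have nw: "(norm (w - y))\<^sup>2 = (norm (z - y))\<^sup>2 + 2 * t * ((z - y) \<bullet> (u - z)) + t\<^sup>2 * (norm (u - z))\<^sup>2"
      unfolding wy power2_norm_eq_inner
      by (simp add: inner_add_left inner_add_right inner_commute power2_eq_square algebra_simps)
    have yz: "(z - y) \<bullet> (u - z) = - ((y - z) \<bullet> (u - z))"
      by (simp add: inner_diff_left)
    have "0 \<le> t * ((h u - h z - c * ((y - z) \<bullet> (u - z))) + t * (c / 2 * (norm (u - z))\<^sup>2))"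
      using min[OF \<open>w \<in> C\<close>] hw unfolding nw yz by (simp add: algebra_simps power2_eq_square)
    then show ?thesis
      using t by (simp add: zero_le_mult_iff)
  qed
  from nonneg_if_perturbations_nonneg[OF this] show ?thesis by simp
qed

text \<open>The quadratic growth \<open>c/2 \<parallel>u - z\<parallel>\<^sup>2\<close> that, for \<open>c > 0\<close>, the strong convexity of the objective
  adds to the mere minimality of \<open>z\<close>.\<close>
lemma minimizer_plus_quadratic_three_point:
  fixes h :: "'a::real_inner \<Rightarrow> real"
  assumes h: "convex_on C h" and z: "z \<in> C" and u: "u \<in> C"
    and min: "\<And>w. w \<in> C \<Longrightarrow> h z + c / 2 * (norm (z - y))\<^sup>2 \<le> h w + c / 2 * (norm (w - y))\<^sup>2"
  shows "h z + c / 2 * (norm (z - y))\<^sup>2 + c / 2 * (norm (u - z))\<^sup>2 \<le> h u + c / 2 * (norm (u - y))\<^sup>2"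
proof -
  have "(norm (u - y))\<^sup>2 = (norm (z - y))\<^sup>2 + (norm (u - z))\<^sup>2 - 2 * ((y - z) \<bullet> (u - z))"
    unfolding power2_norm_eq_inner by (simp add: inner_diff_left inner_diff_right inner_commute)
  then have "c / 2 * (norm (u - y))\<^sup>2
      = c / 2 * (norm (z - y))\<^sup>2 + c / 2 * (norm (u - z))\<^sup>2 - c * ((y - z) \<bullet> (u - z))"
    by (simp only: right_diff_distrib distrib_left)
  with minimizer_plus_quadratic_subgradient[OF assms] show ?thesis by linarith
qed

section \<open>Linearization of smooth convex functions\<close>

lemma GDERIV_along_line:
  fixes h :: "'a::real_inner \<Rightarrow> real"
  assumes "\<And>z. GDERIV h z :> Dh z"
  shows "((\<lambda>t. h (y + t *\<^sub>R w)) has_real_derivative Dh (y + t *\<^sub>R w) \<bullet> w) (at t within S)"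
proof -
  have "((\<lambda>t. y + t *\<^sub>R w) has_derivative (\<lambda>r. r *\<^sub>R w)) (at t within S)"
    by (auto intro!: derivative_eq_intros)
  from has_derivative_compose[OF this, of h "\<lambda>v. v \<bullet> Dh (y + t *\<^sub>R w)"]
  show ?thesis
    using assms[of "y + t *\<^sub>R w"] unfolding gderiv_def has_field_derivative_def
    by (simp add: inner_commute mult.commute[of "w \<bullet> _"] mult_commute_abs)
qed

lemma linearization_le_convex:
  fixes h :: "'a::real_inner \<Rightarrow> real"
  assumes h: "convex_on UNIV h" and Dh: "\<And>z. GDERIV h z :> Dh z"
  shows "lin h Dh u y \<le> h u"
proof -
  let ?p = "\<lambda>t. h (y + t *\<^sub>R (u - y))"
  have "convex_on UNIV ?p"
  proof (rule convex_onI)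
    fix t a b :: real
    assume t: "0 < t" "t < 1"
    have "y + ((1 - t) *\<^sub>R a + t *\<^sub>R b) *\<^sub>R (u - y)
        = (1 - t) *\<^sub>R (y + a *\<^sub>R (u - y)) + t *\<^sub>R (y + b *\<^sub>R (u - y))"
      by (simp add: algebra_simps)
    then show "?p ((1 - t) *\<^sub>R a + t *\<^sub>R b) \<le> (1 - t) * ?p a + t * ?p b"
      using convex_onD[OF h, of t] t by auto
  qed simp
  from convex_on_imp_above_tangent[OF this, of 0 1 "Dh (y + 0 *\<^sub>R (u - y)) \<bullet> (u - y)"]
    GDERIV_along_line[OF Dh, of y "u - y" 0]
  show ?thesis by (simp add: lin_def)
qed

text \<open>Restricted to the segment from \<open>y\<close> to \<open>u\<close>, the difference of the two sides is a function of one
  real variable whose derivative is bounded by the Lipschitz condition. Letting this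
  bound grow with the position in the segment yields the sharp factor \<open>M/2\<close>.\<close>
lemma descent_lemma:
  fixes h :: "'a::real_inner \<Rightarrow> real"
  assumes Dh: "\<And>z. GDERIV h z :> Dh z" and lip: "M-lipschitz_on UNIV Dh"
  shows "h u \<le> lin h Dh u y + M / 2 * (norm (u - y))\<^sup>2"
proof -
  let ?w = "u - y"
  let ?p = "\<lambda>t. h (y + t *\<^sub>R ?w) - t * (Dh y \<bullet> ?w) - M / 2 * t\<^sup>2 * (norm ?w)\<^sup>2"
  have "?p 1 \<le> ?p 0"
  proof (rule DERIV_nonpos_imp_nonincreasing[of 0 1 ?p])
    fix t :: real
    assume t: "0 \<le> t" "t \<le> 1"
    let ?D = "Dh (y + t *\<^sub>R ?w) \<bullet> ?w - Dh y \<bullet> ?w - M * t * (norm ?w)\<^sup>2"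
    have "(?p has_real_derivative ?D) (at t)"
      by (rule derivative_eq_intros GDERIV_along_line[OF Dh] refl)+ simp
    moreover have "?D \<le> 0"
    proof -
      have "Dh (y + t *\<^sub>R ?w) \<bullet> ?w - Dh y \<bullet> ?w = (Dh (y + t *\<^sub>R ?w) - Dh y) \<bullet> ?w"
        by (simp add: inner_diff_left)
      also have "\<dots> \<le> norm (Dh (y + t *\<^sub>R ?w) - Dh y) * norm ?w"
        by (rule norm_cauchy_schwarz)
      also have "\<dots> \<le> (M * (t * norm ?w)) * norm ?w"
        using lipschitz_onD[OF lip, of "y + t *\<^sub>R ?w" y] t
        by (intro mult_right_mono) (auto simp: dist_norm)
      finally show ?thesis by (simp add: power2_eq_square)
    qed
    ultimately show "\<exists>D. DERIV ?p t :> D \<and> D \<le> 0" by blast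
  qed simp
  then show ?thesis by (simp add: lin_def)
qed

section \<open>The maximal constraint violation\<close>

lemma max_violation_ge_0:
  assumes "1 \<le> m" shows "0 \<le> max_violation m h u"
  using assms unfolding max_violation_def by (subst Max_ge_iff) (auto intro!: bexI[of _ 1])

lemma max_violation_le_iff:
  assumes "1 \<le> m" "0 \<le> a"
  shows "max_violation m h u \<le> a \<longleftrightarrow> (\<forall>i\<in>{1..m}. h i u \<le> a)"
  using assms unfolding max_violation_def by (subst Max_le_iff) auto

lemma le_max_violation:
  assumes "i \<in> {1..m}" shows "h i u \<le> max_violation m h u"
proof -
  have "max (h i u) 0 \<le> max_violation m h u"
    using assms unfolding max_violation_def by (intro Max_ge) auto
  then show ?thesis by simp
qed

lemma convex_on_max_violation:
  assumes m: "1 \<le> m" and C: "convex C" and h: "\<And>i. i \<in> {1..m} \<Longrightarrow> convex_on C (h i)"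
  shows "convex_on C (max_violation m h)"
proof (rule convex_onI[OF _ C])
  fix t u v
  assume t: "0 < t" "t < (1::real)" and uv: "u \<in> C" "v \<in> C"
  show "max_violation m h ((1 - t) *\<^sub>R u + t *\<^sub>R v)
      \<le> (1 - t) * max_violation m h u + t * max_violation m h v"
  proof (subst max_violation_le_iff[OF m])
    show "\<forall>i\<in>{1..m}. h i ((1 - t) *\<^sub>R u + t *\<^sub>R v)
      \<le> (1 - t) * max_violation m h u + t * max_violation m h v"
    proof
      fix i assume i: "i \<in> {1..m}"
      have "h i ((1 - t) *\<^sub>R u + t *\<^sub>R v) \<le> (1 - t) * h i u + t * h i v"
        using convex_onD[OF h[OF i], of t u v] t uv by auto
      also have "\<dots> \<le> (1 - t) * max_violation m h u + t * max_violation m h v"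
        using t le_max_violation[OF i, of h] by (intro add_mono mult_left_mono) auto
      finally show "h i ((1 - t) *\<^sub>R u + t *\<^sub>R v) \<le> \<dots>" .
    qed
  qed (use t max_violation_ge_0[OF m, of h] in auto)
qed

lemma continuous_on_max_violation:
  fixes h :: "nat \<Rightarrow> 'a::euclidean_space \<Rightarrow> real"
  assumes "1 \<le> m" "\<And>i. i \<in> {1..m} \<Longrightarrow> convex_on UNIV (h i)"
  shows "continuous_on S (max_violation m h)"
proof -
  have "convex_on UNIV (max_violation m h)"
    using assms by (intro convex_on_max_violation) auto
  from convex_on_continuous[OF open_UNIV this] show ?thesis
    by (rule continuous_on_subset) simp
qed

section \<open>Accumulation points and geometric convergence\<close>

text \<open>Replaces subsequences by recurrence of the sequence to every ball, a description in which
  closedness is immediate.\<close>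
lemma accumulation_points_iff:
  fixes z :: "nat \<Rightarrow> 'a::metric_space"
  shows "p \<in> accumulation_points z \<longleftrightarrow> (\<forall>e>0. \<forall>N. \<exists>k\<ge>N. dist (z k) p < e)"
proof
  assume "p \<in> accumulation_points z"
  then obtain r where r: "strict_mono r" "(z \<circ> r) \<longlonglongrightarrow> p"
    by (auto simp: accumulation_points_def)
  show "\<forall>e>0. \<forall>N. \<exists>k\<ge>N. dist (z k) p < e"
  proof (intro allI impI)
    fix e :: real and N :: nat
    assume "0 < e"
    with r(2) obtain M where "\<And>j. j \<ge> M \<Longrightarrow> dist (z (r j)) p < e"
      unfolding lim_sequentially by auto
    moreover have "r (max M N) \<ge> N"
      using seq_suble[OF r(1), of "max M N"] by simp
    ultimately show "\<exists>k\<ge>N. dist (z k) p < e" by (meson max.cobounded1)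
  qed
next
  assume *: "\<forall>e>0. \<forall>N. \<exists>k\<ge>N. dist (z k) p < e"
  have "\<exists>r. \<forall>n. dist (z (r n)) p < inverse (real (Suc n)) \<and> r n < r (Suc n)"
  proof (rule dependent_nat_choice)
    show "\<exists>k. dist (z k) p < inverse (real (Suc 0))" using *[rule_format, of 1 0] by auto
    show "\<exists>l. dist (z l) p < inverse (real (Suc (Suc n))) \<and> k < l" for k n
      using *[rule_format, of "inverse (real (Suc (Suc n)))" "Suc k"] by auto
  qed
  then obtain r where r: "\<And>n. dist (z (r n)) p < inverse (real (Suc n))" "strict_mono r"
    by (auto simp: strict_mono_Suc_iff)
  have "(\<lambda>n. dist (z (r n)) p) \<longlonglongrightarrow> 0"
    using r(1) by (intro tendsto_sandwich[OF _ _ tendsto_const LIMSEQ_inverse_real_of_nat])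
      (auto intro!: always_eventually less_imp_le)
  then have "(z \<circ> r) \<longlonglongrightarrow> p"
    by (simp add: tendsto_dist_iff[of _ p] o_def)
  with r(2) show "p \<in> accumulation_points z"
    by (auto simp: accumulation_points_def)
qed

lemma accumulation_points_bounded:
  fixes z :: "nat \<Rightarrow> 'a::heine_borel"
  assumes z: "bounded (range z)"
  shows "accumulation_points z \<noteq> {}" and "compact (accumulation_points z)"
proof -
  show "accumulation_points z \<noteq> {}"
    using bounded_imp_convergent_subsequence[OF z] by (auto simp: accumulation_points_def)
  have "closure (accumulation_points z) \<subseteq> accumulation_points z"
  proof
    fix p
    assume "p \<in> closure (accumulation_points z)"
    then have *: "\<forall>e>0. \<exists>q\<in>accumulation_points z. dist q p < e"
      by (simp add: closure_approachable)
    show "p \<in> accumulation_points z"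
      unfolding accumulation_points_iff
    proof (intro allI impI)
      fix e :: real and N :: nat
      assume "0 < e"
      then obtain q where q: "q \<in> accumulation_points z" "dist q p < e / 2"
        using * half_gt_zero by blast
      then obtain k where "k \<ge> N" "dist (z k) q < e / 2"
        using \<open>0 < e\<close> half_gt_zero unfolding accumulation_points_iff by blast
      then show "\<exists>k\<ge>N. dist (z k) p < e"
        using q(2) dist_triangle_half_l[of q "z k" e p] by (metis dist_commute dist_triangle_half_r)
    qed
  qed
  moreover have "accumulation_points z \<subseteq> closure (range z)"
    unfolding accumulation_points_def by (auto simp: closure_sequential o_def) (metis rangeI)
  then have "bounded (accumulation_points z)"
    using z bounded_closure bounded_subset by blast
  ultimately show "compact (accumulation_points z)"
    by (simp add: compact_eq_bounded_closed closure_subset_eq)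
qed

text \<open>The energy estimate below compares indices \<open>k\<close> and \<open>k + 2\<close> only, so the odd and the even
  subsequence need separate starting values.\<close>
lemma two_step_contraction_geometric:
  fixes e :: "nat \<Rightarrow> real"
  assumes q: "0 < q" and nonneg: "\<And>k. 0 \<le> e k"
    and contr: "\<And>k. k \<ge> K \<Longrightarrow> e (Suc (Suc k)) \<le> q\<^sup>2 * e k"
  obtains A where "0 < A" "\<And>k. k \<ge> K \<Longrightarrow> e k \<le> A * q ^ k"
proof -
  define A where "A = 1 + e K / q ^ K + e (Suc K) / q ^ Suc K"
  have "0 < A"
    unfolding A_def using nonneg q by (intro add_pos_nonneg) auto
  have "e k \<le> A * q ^ k \<and> e (Suc k) \<le> A * q ^ Suc k" if "k \<ge> K" for k
    using that
  proof (induction k rule: dec_induct)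
    case base
    have "e K / q ^ K \<le> A" "e (Suc K) / q ^ Suc K \<le> A"
      using nonneg q unfolding A_def by auto
    then show ?case using q by (simp add: divide_le_eq)
  next
    case (step n)
    have "e (Suc (Suc n)) \<le> q\<^sup>2 * (A * q ^ n)"
      using contr[OF step(1)] step(3) q by (meson mult_left_mono order_trans zero_le_power2)
    with step show ?case by (simp add: power2_eq_square mult_ac)
  qed
  with \<open>0 < A\<close> that show ?thesis by blast
qed

lemma geometric_steps_converge:
  fixes x :: "nat \<Rightarrow> 'a::banach"
  assumes q: "0 < q" "q < 1"
    and steps: "\<And>k. k \<ge> K \<Longrightarrow> norm (x (Suc k) - x k) \<le> A * q ^ k"
  obtains l where "x \<longlonglongrightarrow> l" "\<And>k. k \<ge> K \<Longrightarrow> norm (x k - l) \<le> A / (1 - q) * q ^ k"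
proof -
  have "0 \<le> A * q ^ K" using steps[of K] norm_ge_zero order_trans by blast
  then have A: "0 \<le> A" using zero_less_power[OF q(1), of K] by (simp add: zero_le_mult_iff)
  have partial: "norm (x (k + j) - x k) \<le> A / (1 - q) * q ^ k * (1 - q ^ j)" if k: "k \<ge> K" for k j
  proof (induction j)
    case (Suc j)
    have "norm (x (k + Suc j) - x k) \<le> norm (x (Suc (k + j)) - x (k + j)) + norm (x (k + j) - x k)"
      using norm_triangle_ineq[of "x (Suc (k + j)) - x (k + j)" "x (k + j) - x k"] by simp
    also have "\<dots> \<le> A * q ^ (k + j) + A / (1 - q) * q ^ k * (1 - q ^ j)"
      using steps[of "k + j"] k Suc by (intro add_mono) auto
    also have "\<dots> = A / (1 - q) * q ^ k * (1 - q ^ Suc j)"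
      using q by (simp add: power_add divide_simps) (simp add: algebra_simps)
    finally show ?case .
  qed simp
  have bound: "norm (x (k + j) - x k) \<le> A / (1 - q) * q ^ k" if "k \<ge> K" for k j
  proof -
    have "A / (1 - q) * q ^ k * (1 - q ^ j) \<le> A / (1 - q) * q ^ k * 1"
      using A q by (intro mult_left_mono) auto
    with partial[OF that, of j] show ?thesis by simp
  qed
  have "Cauchy x"
    unfolding Cauchy_altdef
  proof (intro allI impI)
    fix e :: real
    assume e: "0 < e"
    have "(\<lambda>k. A / (1 - q) * q ^ k) \<longlonglongrightarrow> 0"
      using LIMSEQ_power_zero[of q] q by (auto intro!: tendsto_mult_right_zero)
    then have "\<forall>\<^sub>F k in sequentially. A / (1 - q) * q ^ k < e"
      using e by (rule order_tendstoD)
    then obtain M where M: "\<And>k. k \<ge> M \<Longrightarrow> A / (1 - q) * q ^ k < e"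
      unfolding eventually_sequentially by blast
    show "\<exists>M. \<forall>a\<ge>M. \<forall>b>a. dist (x a) (x b) < e"
    proof (intro exI allI impI)
      fix a b
      assume "max M K \<le> a" "a < b"
      then show "dist (x a) (x b) < e"
        using M[of a] bound[of a "b - a"] by (simp add: dist_norm norm_minus_commute)
    qed
  qed
  then obtain l where l: "x \<longlonglongrightarrow> l"
    using Cauchy_convergent convergent_def by blast
  have "norm (x k - l) \<le> A / (1 - q) * q ^ k" if k: "k \<ge> K" for k
  proof (rule tendsto_upperbound)
    show "(\<lambda>j. norm (x k - x (k + j))) \<longlonglongrightarrow> norm (x k - l)"
      using LIMSEQ_ignore_initial_segment[OF l, of k]
      by (intro tendsto_intros) (simp add: add.commute)
    show "\<forall>\<^sub>F j in sequentially. norm (x k - x (k + j)) \<le> A / (1 - q) * q ^ k"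
      using bound[OF k] by (simp add: norm_minus_commute)
  qed simp
  with l that show ?thesis by blast
qed

text \<open>If increases went on forever, the steps of fixed size \<open>d\<close> would push the sequence above \<open>B\<close>, where
  no increase is permitted from index \<open>K\<close> on.\<close>
lemma eventually_constant_if_increases_bounded:
  fixes \<theta> :: "nat \<Rightarrow> real"
  assumes d: "0 < d" and step: "\<And>k. \<theta> (Suc k) = \<theta> k \<or> \<theta> (Suc k) = \<theta> k + d"
    and bd: "\<And>k. k \<ge> K \<Longrightarrow> \<theta> (Suc k) \<noteq> \<theta> k \<Longrightarrow> \<theta> k \<le> B"
  obtains N where "\<And>k. k \<ge> N \<Longrightarrow> \<theta> k = \<theta> N"
proof (rule ccontr)
  assume not_const: "\<not> thesis"
  have frequent: "\<exists>k\<ge>N. \<theta> (Suc k) = \<theta> k + d" for N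
  proof (rule ccontr)
    assume *: "\<not> ?thesis"
    have "\<theta> k = \<theta> N" if "k \<ge> N" for k
      using that
    proof (induction k rule: dec_induct)
      case (step n)
      then show ?case using assms(2)[of n] * by auto
    qed simp
    with that not_const show False by blast
  qed
  have mono: "incseq \<theta>"
    using d step by (intro incseq_SucI) (metis add_le_same_cancel1 less_imp_le order_refl not_le)
  have unbounded: "\<exists>k. \<theta> 0 + real n * d \<le> \<theta> k" for n
  proof (induction n)
    case (Suc n)
    then obtain k where k: "\<theta> 0 + real n * d \<le> \<theta> k" by blast
    obtain l where "l \<ge> k" "\<theta> (Suc l) = \<theta> l + d" using frequent by blast
    with k incseqD[OF mono \<open>l \<ge> k\<close>] show ?case
      by (intro exI[of _ "Suc l"]) (simp add: algebra_simps)
  qed auto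
  obtain n where "(B - \<theta> 0) / d < real n" using reals_Archimedean2 by blast
  then have "B < \<theta> 0 + real n * d" using d by (simp add: divide_less_eq)
  moreover obtain k where "\<theta> 0 + real n * d \<le> \<theta> k" using unbounded by blast
  moreover obtain l where "l \<ge> max k K" "\<theta> (Suc l) = \<theta> l + d" using frequent by blast
  ultimately show False
    using bd[of l] incseqD[OF mono, of k l] d by simp
qed

section \<open>The KL inequality with exponent one half\<close>

text \<open>Makes every convex subgradient a test vector for the KL inequality. The difference quotients in
  the regular subdifferential are nonnegative everywhere, and not just in the limit.\<close>
lemma global_subgradient_in_limiting_subdiff:
  fixes f :: "'a::real_inner \<Rightarrow> ereal"
  assumes fin: "f z = ereal a" and sub: "\<And>u. ereal (a + v \<bullet> (u - z)) \<le> f u"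
  shows "v \<in> limiting_subdiff f z"
proof -
  have "0 \<le> (f u - f z - ereal (v \<bullet> (u - z))) / ereal (norm (u - z))" if "u \<noteq> z" for u
  proof -
    have "0 \<le> f u - f z - ereal (v \<bullet> (u - z))"
      using sub[of u] fin by (cases "f u") auto
    then show ?thesis
      using that by (intro zero_le_divide_ereal) auto
  qed
  then have "v \<in> regular_subdiff f z"
    using fin unfolding regular_subdiff_def
    by (auto intro!: Liminf_bounded simp: eventually_at_filter)
  then show ?thesis
    \<comment> \<open>The constant sequences witness the limit.\<close>
    using fin tendsto_const[of z] tendsto_const[of "f z"] tendsto_const[of v]
    unfolding limiting_subdiff_def by fastforce
qed

text \<open>For exponent \<open>1/2\<close> the desingularizing function is \<open>\<rho> \<surd>t\<close>, with derivative \<open>\<rho> / (2 \<surd>t)\<close>. Clearing the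
  denominator and squaring turns the KL inequality into a bound of the function gap by the squared
  length of any subgradient.\<close>
lemma kl_half_at_bound:
  fixes f :: "'a::real_inner \<Rightarrow> ereal"
  assumes "kl_at f (1 / 2) p" and fp: "f p = ereal a"
  obtains r U \<rho> where "0 < r" "open U" "p \<in> U"
    "\<And>z b v. z \<in> U \<Longrightarrow> f z = ereal b \<Longrightarrow> a < b \<Longrightarrow> b < a + r
       \<Longrightarrow> v \<in> limiting_subdiff f z \<Longrightarrow> b - a \<le> (\<rho> / 2)\<^sup>2 * (norm v)\<^sup>2"
proof -
  obtain r' :: ereal and U and \<rho> :: real where r': "0 < r'" "open U" "p \<in> U" "0 < \<rho>"
    and kl: "\<And>z. z \<in> U \<Longrightarrow> f p < f z \<Longrightarrow> f z < f p + r' \<Longrightarrow>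
      1 \<le> ereal (deriv (\<lambda>t. \<rho> * t powr (1 - 1 / 2)) (real_of_ereal (f z - f p)))
               * edist_to 0 (limiting_subdiff f z)"
    using assms(1) unfolding kl_at_def by blast
  obtain r :: real where r: "0 < r" "ereal r \<le> r'"
    using r'(1) by (metis ereal_dense2 ereal_less(2) less_imp_le)
  have "b - a \<le> (\<rho> / 2)\<^sup>2 * (norm v)\<^sup>2"
    if z: "z \<in> U" "f z = ereal b" "a < b" "b < a + r" and v: "v \<in> limiting_subdiff f z"
    for z b v
  proof -
    define t where "t = b - a"
    have t: "0 < t" using z by (simp add: t_def)
    have "((\<lambda>t. \<rho> * t powr (1 - 1 / 2)) has_real_derivative \<rho> * (1 / 2 * t powr (- 1 / 2))) (at t)"
      using t by (auto intro!: derivative_eq_intros)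
    then have deriv: "deriv (\<lambda>t. \<rho> * t powr (1 - 1 / 2)) t = \<rho> / (2 * sqrt t)"
      using t by (simp add: DERIV_imp_deriv powr_minus powr_half_sqrt field_simps)
    have "edist_to 0 (limiting_subdiff f z) \<le> ereal (norm v)"
      unfolding edist_to_def using v by (intro INF_lower2[of v]) auto
    moreover have "f z < f p + r'"
    proof -
      have "f z < f p + ereal r" using z fp by simp
      also have "\<dots> \<le> f p + r'" using r(2) by (intro add_left_mono)
      finally show ?thesis .
    qed
    then have "1 \<le> ereal (\<rho> / (2 * sqrt t)) * edist_to 0 (limiting_subdiff f z)"
      using kl[of z] z fp deriv by (simp add: t_def)
    ultimately have "1 \<le> ereal (\<rho> / (2 * sqrt t)) * ereal (norm v)"
      using r'(4) t by (meson ereal_mult_left_mono order_trans ereal_less_eq(5)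
          divide_nonneg_nonneg less_imp_le mult_nonneg_nonneg real_sqrt_ge_zero zero_le_numeral)
    then have "1 \<le> \<rho> / (2 * sqrt t) * norm v"
      by (simp add: one_ereal_def)
    then have "sqrt t \<le> \<rho> / 2 * norm v"
      using t by (simp add: field_simps)
    then have "(sqrt t)\<^sup>2 \<le> (\<rho> / 2 * norm v)\<^sup>2"
      using t by (intro power_mono) auto
    then show ?thesis
      using t by (simp add: t_def power_mult_distrib power_divide)
  qed
  with r(1) r'(2,3) that show ?thesis by blast
qed

text \<open>On a compact domain the KL inequalities at the individual minimizers combine into one inequality
  with the same constant wherever the value is close to the minimum. Otherwise there are points with
  values tending to \<open>\<mu>\<close> that violate the bound with constants tending to infinity; a cluster point
  of them is a minimizer, has \<open>0\<close> as a subgradient, and the KL inequality there contradicts the violation. Hence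
  it need not be known beforehand which minimizer an algorithm approaches.\<close>
lemma kl_half_uniform:
  fixes f :: "'a::real_inner \<Rightarrow> ereal" and \<phi> :: "'a \<Rightarrow> real"
  assumes kl: "kl_function f (1 / 2)" and C: "compact C" and cont: "continuous_on C \<phi>"
    and f_in: "\<And>u. u \<in> C \<Longrightarrow> f u = ereal (\<phi> u)" and f_out: "\<And>u. u \<notin> C \<Longrightarrow> f u = \<infinity>"
    and low: "\<And>u. u \<in> C \<Longrightarrow> \<mu> \<le> \<phi> u"
  obtains c r where "0 < c" "0 < r"
    "\<And>z v. z \<in> C \<Longrightarrow> \<phi> z < \<mu> + r \<Longrightarrow> (\<And>u. u \<in> C \<Longrightarrow> \<phi> z + v \<bullet> (u - z) \<le> \<phi> u)
       \<Longrightarrow> \<phi> z - \<mu> \<le> c * (norm v)\<^sup>2"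
proof (rule ccontr)
  assume neg: "\<not> thesis"
  let ?good = "\<lambda>c r. \<forall>z v. z \<in> C \<longrightarrow> \<phi> z < \<mu> + r \<longrightarrow> (\<forall>u\<in>C. \<phi> z + v \<bullet> (u - z) \<le> \<phi> u)
       \<longrightarrow> \<phi> z - \<mu> \<le> c * (norm v)\<^sup>2"
  have "\<exists>z v. z \<in> C \<and> \<phi> z < \<mu> + inverse (real (Suc n)) \<and>
      (\<forall>u\<in>C. \<phi> z + v \<bullet> (u - z) \<le> \<phi> u) \<and> real (Suc n) * (norm v)\<^sup>2 < \<phi> z - \<mu>" for n
  proof (rule ccontr)
    assume "\<not> ?thesis"
    then have "?good (real (Suc n)) (inverse (real (Suc n)))" by (meson not_le)
    then show False using neg that[of "real (Suc n)" "inverse (real (Suc n))"] by auto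
  qed
  then obtain z v where z: "\<And>n. z n \<in> C" "\<And>n. \<phi> (z n) < \<mu> + inverse (real (Suc n))"
    and v: "\<And>n u. u \<in> C \<Longrightarrow> \<phi> (z n) + v n \<bullet> (u - z n) \<le> \<phi> u"
    and big: "\<And>n. real (Suc n) * (norm (v n))\<^sup>2 < \<phi> (z n) - \<mu>"
    by metis
  obtain p q where p: "p \<in> C" "strict_mono q" "(z \<circ> q) \<longlonglongrightarrow> p"
    using C z(1) unfolding compact_eq_seq_compact_metric seq_compact_def by metis
  have "(\<lambda>n. \<phi> (z n)) \<longlonglongrightarrow> \<mu>"
  proof (rule tendsto_sandwich)
    show "\<forall>\<^sub>F n in sequentially. \<phi> (z n) \<le> \<mu> + inverse (real (Suc n))"
      using z(2) by (intro always_eventually allI less_imp_le)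
    show "\<forall>\<^sub>F n in sequentially. \<mu> \<le> \<phi> (z n)"
      using low[OF z(1)] by simp
    show "(\<lambda>n. \<mu> + inverse (real (Suc n))) \<longlonglongrightarrow> \<mu>"
      using tendsto_add[OF tendsto_const LIMSEQ_inverse_real_of_nat, of \<mu>] by simp
  qed (rule tendsto_const)
  then have lim: "(\<lambda>n. \<phi> (z (q n))) \<longlonglongrightarrow> \<mu>"
    using LIMSEQ_subseq_LIMSEQ[OF _ p(2)] by (auto simp: o_def)
  moreover have "(\<lambda>n. \<phi> (z (q n))) \<longlonglongrightarrow> \<phi> p"
    using continuous_on_tendsto_compose[OF cont p(3) p(1)] z(1) by (simp add: o_def)
  ultimately have \<phi>p: "\<phi> p = \<mu>" using LIMSEQ_unique by blast
  have subgrad: "w \<in> limiting_subdiff f y" if "y \<in> C" "\<And>u. u \<in> C \<Longrightarrow> \<phi> y + w \<bullet> (u - y) \<le> \<phi> u" for w y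
    using that f_in f_out
    by (intro global_subgradient_in_limiting_subdiff[of f y "\<phi> y"]) (auto, metis ereal_less_eq(1,3))
  have "0 \<in> limiting_subdiff f p"
    using p(1) low \<phi>p by (intro subgrad) auto
  then have "kl_at f (1 / 2) p"
    using kl unfolding kl_function_def by blast
  then obtain r U \<rho> where r: "0 < r" "open U" "p \<in> U"
    "\<And>z b v. z \<in> U \<Longrightarrow> f z = ereal b \<Longrightarrow> \<mu> < b \<Longrightarrow> b < \<mu> + r
       \<Longrightarrow> v \<in> limiting_subdiff f z \<Longrightarrow> b - \<mu> \<le> (\<rho> / 2)\<^sup>2 * (norm v)\<^sup>2"
    using kl_half_at_bound[of f p \<mu>] f_in[OF p(1)] \<phi>p by metis
  have "\<forall>\<^sub>F n in sequentially. z (q n) \<in> U"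
    using topological_tendstoD[OF p(3) r(2,3)] by (simp add: o_def)
  moreover have "\<forall>\<^sub>F n in sequentially. \<phi> (z (q n)) < \<mu> + r"
    using lim r(1) by (intro order_tendstoD) auto
  moreover have "\<forall>\<^sub>F n in sequentially. (\<rho> / 2)\<^sup>2 \<le> real n"
    using filterlim_real_sequentially by (simp add: filterlim_at_top)
  ultimately have "\<forall>\<^sub>F n in sequentially. False"
  proof eventually_elim
    case (elim n)
    have "0 \<le> real (Suc (q n)) * (norm (v (q n)))\<^sup>2" by simp
    then have "\<mu> < \<phi> (z (q n))" using big[of "q n"] by linarith
    then have "\<phi> (z (q n)) - \<mu> \<le> (\<rho> / 2)\<^sup>2 * (norm (v (q n)))\<^sup>2"
      using elim z(1) v f_in by (intro r(4) subgrad) auto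
    also have "\<dots> \<le> real (Suc (q n)) * (norm (v (q n)))\<^sup>2"
      using elim seq_suble[OF p(2), of n] by (intro mult_right_mono) auto
    finally show False using big[of "q n"] by simp
  qed
  then show False by simp
qed

section \<open>The three-point inequality and descent of the potential\<close>

lemma convex_on_lin: "convex_on UNIV (\<lambda>u. lin h Dh u w)"
proof (rule convex_onI)
  fix t :: real and u v
  show "lin h Dh ((1 - t) *\<^sub>R u + t *\<^sub>R v) w \<le> (1 - t) * lin h Dh u w + t * lin h Dh v w"
    by (simp add: lin_def inner_add_right inner_diff_right algebra_simps)
qed simp

locale esqm_iteration =
  fixes P :: "'a::euclidean_space \<Rightarrow> real"
    and m :: nat
    and g :: "nat \<Rightarrow> 'a \<Rightarrow> real"
    and G :: "nat \<Rightarrow> 'a \<Rightarrow> 'a"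
    and C :: "'a set"
    and L :: "nat \<Rightarrow> real"
    and Lg mhat d :: real
    and \<beta> s \<theta> :: "nat \<Rightarrow> real"
    and x :: "nat \<Rightarrow> 'a"
  assumes P_convex: "convex_on UNIV P"
    and m_pos: "1 \<le> m"
    and g_convex: "\<forall>i\<in>{1..m}. convex_on UNIV (g i)"
    and g_gradient: "\<forall>i\<in>{1..m}. \<forall>z. GDERIV (g i) z :> (G i z)"
    and L_pos: "\<forall>i\<in>{1..m}. 0 < L i"
    and gradient_lipschitz: "\<forall>i\<in>{1..m}. (L i)-lipschitz_on UNIV (G i)"
    and C_set: "C \<noteq> {}" "compact C" "convex C"
    and slater: "\<exists>xhat\<in>C. \<forall>i\<in>{1..m}. g i xhat < 0"
    and Lg_eq: "Lg = Max (L ` {1..m})"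
    and mhat_eq: "mhat = (INF z\<in>C. P z)"
    and algorithm: "esqm_e P m g G C Lg d \<beta> x s \<theta>"
begin

abbreviation Y :: "nat \<Rightarrow> 'a" where "Y \<equiv> extrapolation \<beta> x"

abbreviation viol :: "'a \<Rightarrow> real" where "viol \<equiv> max_violation m g"

definition lin_viol :: "nat \<Rightarrow> 'a \<Rightarrow> real" where
  "lin_viol k = max_violation m (\<lambda>i u. lin (g i) (G i) u (Y k))"

text \<open>The exact penalty function divided by the penalty parameter; on \<open>C\<close>, for the eventual
  parameter, it is the function assumed to have the KL property.\<close>
definition pen :: "real \<Rightarrow> 'a \<Rightarrow> real" where
  "pen t u = (P u - mhat) / t + viol u"

text \<open>The real value of the potential at \<open>(x\<^sub>k, x\<^sub>k\<^sub>-\<^sub>1, \<theta>\<^sub>k)\<close>; the iterates lie in \<open>C\<close>, so no infinite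
  values occur along the run.\<close>
definition energy :: "nat \<Rightarrow> real" where
  "energy k = pen (\<theta> k) (x k) + Lg / 2 * (norm (x k - x (k - 1)))\<^sup>2"

lemma L_le_Lg: "i \<in> {1..m} \<Longrightarrow> L i \<le> Lg"
  unfolding Lg_eq by (intro Max_ge) auto

lemma Lg_pos: "0 < Lg"
  using L_le_Lg[of 1] L_pos m_pos by force

lemma continuous_on_P: "continuous_on S P"
  using convex_on_continuous[OF open_UNIV P_convex] by (rule continuous_on_subset) simp

lemma continuous_on_viol: "continuous_on S viol"
  using m_pos g_convex by (intro continuous_on_max_violation) auto

lemma mhat_le: "u \<in> C \<Longrightarrow> mhat \<le> P u"
  unfolding mhat_eq
  by (intro cINF_lower bounded_imp_bdd_below compact_imp_bounded compact_continuous_image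
      continuous_on_P C_set(2))

lemma esqm_initial: "x 0 \<in> C" "0 < \<theta> 0" "0 < d" "0 \<le> \<beta> k" "\<beta> k < 1" "(SUP k. \<beta> k) < 1"
  using algorithm unfolding esqm_e_def by auto

lemma esqm_argmin:
  "is_arg_min (\<lambda>(u, t). P u + \<theta> k * t + \<theta> k * Lg / 2 * (norm (u - Y k))\<^sup>2)
     (\<lambda>(u, t). u \<in> C \<and> 0 \<le> t \<and> (\<forall>i\<in>{1..m}. lin (g i) (G i) u (Y k) \<le> t)) (x (Suc k), s (Suc k))"
  using algorithm unfolding esqm_e_def Let_def by blast

lemma esqm_optimal:
  assumes "u \<in> C" "0 \<le> t" "\<And>i. i \<in> {1..m} \<Longrightarrow> lin (g i) (G i) u (Y k) \<le> t"
  shows "P (x (Suc k)) + \<theta> k * s (Suc k) + \<theta> k * Lg / 2 * (norm (x (Suc k) - Y k))\<^sup>2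
    \<le> P u + \<theta> k * t + \<theta> k * Lg / 2 * (norm (u - Y k))\<^sup>2"
proof (rule ccontr)
  assume "\<not> ?thesis"
  with assms have "\<exists>p. (case p of (u, t) \<Rightarrow> u \<in> C \<and> 0 \<le> t \<and> (\<forall>i\<in>{1..m}. lin (g i) (G i) u (Y k) \<le> t))
      \<and> (case p of (u, t) \<Rightarrow> P u + \<theta> k * t + \<theta> k * Lg / 2 * (norm (u - Y k))\<^sup>2)
        < (case (x (Suc k), s (Suc k)) of (u, t) \<Rightarrow> P u + \<theta> k * t + \<theta> k * Lg / 2 * (norm (u - Y k))\<^sup>2)"
    by (intro exI[of _ "(u, t)"]) simp
  then show False
    using esqm_argmin[of k] unfolding is_arg_min_def by blast
qed

lemma theta_Suc:
  "\<theta> (Suc k) = (if \<forall>i\<in>{1..m}. lin (g i) (G i) (x (Suc k)) (Y k) \<le> 0 then \<theta> k else \<theta> k + d)"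
  using algorithm unfolding esqm_e_def Let_def by blast

lemma theta_Suc_lin_viol: "\<theta> (Suc k) = (if lin_viol k (x (Suc k)) \<le> 0 then \<theta> k else \<theta> k + d)"
  unfolding theta_Suc lin_viol_def by (simp only: max_violation_le_iff[OF m_pos order_refl])

lemma theta_le_Suc: "\<theta> k \<le> \<theta> (Suc k)"
  using esqm_initial(3) by (simp add: theta_Suc)

lemma theta_pos: "0 < \<theta> k"
  using esqm_initial(2) theta_le_Suc by (induction k) (auto intro: less_le_trans)

lemma x_in_C: "x k \<in> C"
proof (cases k)
  case (Suc j)
  then show ?thesis using esqm_argmin[of j] by (simp add: is_arg_min_def)
qed (simp add: esqm_initial)

lemma lin_viol_ge_0: "0 \<le> lin_viol k u"
  unfolding lin_viol_def by (rule max_violation_ge_0[OF m_pos])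

lemma viol_ge_0: "0 \<le> viol u"
  by (rule max_violation_ge_0[OF m_pos])

lemma lin_le_lin_viol: "i \<in> {1..m} \<Longrightarrow> lin (g i) (G i) u (Y k) \<le> lin_viol k u"
  unfolding lin_viol_def by (rule le_max_violation)

lemma lin_viol_convex: "convex_on C (lin_viol k)"
  unfolding lin_viol_def
  by (intro convex_on_max_violation m_pos C_set convex_on_subset[OF convex_on_lin]) auto

lemma lin_viol_le_viol: "lin_viol k u \<le> viol u"
  unfolding lin_viol_def
proof (subst max_violation_le_iff[OF m_pos viol_ge_0], intro ballI)
  fix i assume i: "i \<in> {1..m}"
  have "lin (g i) (G i) u (Y k) \<le> g i u"
    using i g_convex g_gradient by (intro linearization_le_convex) auto
  also have "\<dots> \<le> viol u" using i by (rule le_max_violation)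
  finally show "lin (g i) (G i) u (Y k) \<le> viol u" .
qed

text \<open>The proximal term of the subproblem is chosen to dominate exactly this linearization error.\<close>
lemma viol_le_lin_viol: "viol u \<le> lin_viol k u + Lg / 2 * (norm (u - Y k))\<^sup>2"
proof (subst max_violation_le_iff[OF m_pos])
  show "0 \<le> lin_viol k u + Lg / 2 * (norm (u - Y k))\<^sup>2"
    using lin_viol_ge_0 Lg_pos by simp
  show "\<forall>i\<in>{1..m}. g i u \<le> lin_viol k u + Lg / 2 * (norm (u - Y k))\<^sup>2"
  proof
    fix i assume i: "i \<in> {1..m}"
    have "g i u \<le> lin (g i) (G i) u (Y k) + L i / 2 * (norm (u - Y k))\<^sup>2"
      using i g_gradient gradient_lipschitz by (intro descent_lemma) auto
    also have "\<dots> \<le> lin_viol k u + Lg / 2 * (norm (u - Y k))\<^sup>2"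
      using lin_le_lin_viol[OF i] L_le_Lg[OF i] by (intro add_mono mult_right_mono) auto
    finally show "g i u \<le> \<dots>" .
  qed
qed

lemma subproblem_convex: "convex_on C (\<lambda>u. P u / \<theta> k + lin_viol k u)"
  using theta_pos[of k]
  by (intro convex_on_add convex_on_cdiv lin_viol_convex convex_on_subset[OF P_convex] C_set)
    auto

text \<open>Eliminates the slack variable: for given \<open>u\<close> the cheapest admissible slack is \<open>lin_viol k u\<close>.\<close>
lemma subproblem_minimizer:
  assumes "u \<in> C"
  shows "P (x (Suc k)) / \<theta> k + lin_viol k (x (Suc k)) + Lg / 2 * (norm (x (Suc k) - Y k))\<^sup>2
    \<le> P u / \<theta> k + lin_viol k u + Lg / 2 * (norm (u - Y k))\<^sup>2" (is "?l \<le> ?r")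
proof -
  have feas: "0 \<le> s (Suc k)" "\<forall>i\<in>{1..m}. lin (g i) (G i) (x (Suc k)) (Y k) \<le> s (Suc k)"
    using esqm_argmin[of k] by (auto simp: is_arg_min_def)
  then have "lin_viol k (x (Suc k)) \<le> s (Suc k)"
    unfolding lin_viol_def by (subst max_violation_le_iff[OF m_pos]) auto
  then have "\<theta> k * lin_viol k (x (Suc k)) \<le> \<theta> k * s (Suc k)"
    using theta_pos[of k] by simp
  moreover have "P (x (Suc k)) + \<theta> k * s (Suc k) + \<theta> k * Lg / 2 * (norm (x (Suc k) - Y k))\<^sup>2
    \<le> P u + \<theta> k * lin_viol k u + \<theta> k * Lg / 2 * (norm (u - Y k))\<^sup>2"
    using assms lin_viol_ge_0 lin_le_lin_viol by (intro esqm_optimal) auto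
  moreover have "\<theta> k * ?l = P (x (Suc k)) + \<theta> k * lin_viol k (x (Suc k))
      + \<theta> k * Lg / 2 * (norm (x (Suc k) - Y k))\<^sup>2"
    and "\<theta> k * ?r = P u + \<theta> k * lin_viol k u + \<theta> k * Lg / 2 * (norm (u - Y k))\<^sup>2"
    using theta_pos[of k] by (simp_all add: distrib_left)
  ultimately have "\<theta> k * ?l \<le> \<theta> k * ?r" by linarith
  then show ?thesis
    using theta_pos[of k] by simp
qed

text \<open>The key inequality, the same as for a proximal gradient step on the penalty function. At the new
  iterate the proximal term pays for replacing the linearized violation by the true one, and at \<open>u\<close>
  convexity bounds the linearized violation by the true one. Most later estimates are obtained
  by a choice of \<open>u\<close>.\<close>
lemma pen_three_point:
  assumes u: "u \<in> C"
  shows "pen (\<theta> k) (x (Suc k)) + Lg / 2 * (norm (u - x (Suc k)))\<^sup>2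
    \<le> pen (\<theta> k) u + Lg / 2 * (norm (u - Y k))\<^sup>2"
proof -
  have "P (x (Suc k)) / \<theta> k + lin_viol k (x (Suc k)) + Lg / 2 * (norm (x (Suc k) - Y k))\<^sup>2
      + Lg / 2 * (norm (u - x (Suc k)))\<^sup>2 \<le> P u / \<theta> k + lin_viol k u + Lg / 2 * (norm (u - Y k))\<^sup>2"
    by (rule minimizer_plus_quadratic_three_point[OF subproblem_convex x_in_C u subproblem_minimizer])
  with lin_viol_le_viol[of k u] viol_le_lin_viol[of "x (Suc k)" k] show ?thesis
    by (simp add: pen_def diff_divide_distrib)
qed

text \<open>This monotonicity is the reason for subtracting the infimum \<open>mhat\<close> from the objective: increases of
  the penalty parameter then cannot raise the potential.\<close>
lemma pen_antimono:
  assumes "u \<in> C" "0 < t" "t \<le> t'"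
  shows "pen t' u \<le> pen t u"
  using assms mhat_le[of u] unfolding pen_def by (simp add: divide_left_mono)

lemma pen_ge_0: "u \<in> C \<Longrightarrow> 0 < t \<Longrightarrow> 0 \<le> pen t u"
  using mhat_le[of u] viol_ge_0[of u] unfolding pen_def by simp

lemma continuous_on_pen: "continuous_on S (pen t)"
  unfolding pen_def divide_inverse
  by (intro continuous_intros continuous_on_P continuous_on_viol)

lemma convex_on_pen: "0 < t \<Longrightarrow> convex_on C (pen t)"
  unfolding pen_def diff_conv_add_uminus using m_pos g_convex C_set(3)
  by (intro convex_on_add convex_on_cdiv convex_on_max_violation
      convex_on_subset[OF P_convex] C_set)
    (auto simp: convex_on_const intro: convex_on_subset[of UNIV])

lemma potential_eq:
  assumes "u \<in> C" "0 < t"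
  shows "potential P m g C Lg mhat u v t = ereal (pen t u + Lg / 2 * (norm (u - v))\<^sup>2)"
  using assms by (simp add: potential_def delta_def pen_def field_simps)

text \<open>The three-point inequality with \<open>u = x\<^sub>k\<close>, where the extrapolation contributes only
  \<open>\<beta>\<^sub>k\<^sup>2 \<parallel>x\<^sub>k - x\<^sub>k\<^sub>-\<^sub>1\<parallel>\<^sup>2\<close>.\<close>
lemma energy_decrease:
  "pen (\<theta> k) (x (Suc k)) + Lg / 2 * (norm (x (Suc k) - x k))\<^sup>2
    \<le> energy k - (1 - (\<beta> k)\<^sup>2) * Lg / 2 * (norm (x k - x (k - 1)))\<^sup>2"
proof -
  have "(norm (x k - Y k))\<^sup>2 = (\<beta> k)\<^sup>2 * (norm (x k - x (k - 1)))\<^sup>2"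
    by (simp add: extrapolation_def power_mult_distrib)
  with pen_three_point[OF x_in_C, of k k] show ?thesis
    by (simp add: energy_def norm_minus_commute field_simps)
qed

lemma energy_Suc_le:
  "energy (Suc k) \<le> pen (\<theta> k) (x (Suc k)) + Lg / 2 * (norm (x (Suc k) - x k))\<^sup>2"
  using pen_antimono[OF x_in_C theta_pos theta_le_Suc] by (simp add: energy_def)

lemma energy_ge_0: "0 \<le> energy k"
  using pen_ge_0[OF x_in_C theta_pos] Lg_pos by (simp add: energy_def)

definition descent_const :: real where
  "descent_const = (1 - (SUP k. \<beta> k)\<^sup>2) * Lg / 2"

lemma beta_le_SUP: "\<beta> k \<le> (SUP k. \<beta> k)"
  using esqm_initial(5) by (intro cSUP_upper bdd_aboveI[of _ 1]) (auto intro: less_imp_le)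

lemma descent_const_pos: "0 < descent_const"
proof -
  have "0 \<le> (SUP k. \<beta> k)"
    using beta_le_SUP[of 0] esqm_initial(4)[of 0] by linarith
  then have "(SUP k. \<beta> k)\<^sup>2 < 1"
    using esqm_initial(6) by (simp add: power_less_one_iff abs_square_less_1)
  then show ?thesis
    using Lg_pos by (simp add: descent_const_def)
qed

lemma energy_sufficient_decrease:
  "energy (Suc k) \<le> energy k - descent_const * (norm (x k - x (k - 1)))\<^sup>2"
proof -
  have "(\<beta> k)\<^sup>2 \<le> (SUP k. \<beta> k)\<^sup>2"
    using esqm_initial(4) beta_le_SUP by (intro power_mono)
  then have "descent_const * (norm (x k - x (k - 1)))\<^sup>2
      \<le> (1 - (\<beta> k)\<^sup>2) * Lg / 2 * (norm (x k - x (k - 1)))\<^sup>2"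
    unfolding descent_const_def using Lg_pos
    by (intro mult_right_mono divide_right_mono) auto
  with energy_decrease[of k] energy_Suc_le[of k] show ?thesis by linarith
qed

lemma decseq_energy: "decseq energy"
proof (rule decseq_SucI)
  fix k
  have "0 \<le> descent_const * (norm (x k - x (k - 1)))\<^sup>2"
    using descent_const_pos by simp
  with energy_sufficient_decrease[of k] show "energy (Suc k) \<le> energy k" by linarith
qed

lemma energy_convergent: obtains l where "energy \<longlonglongrightarrow> l"
  using decseq_convergent[OF decseq_energy] energy_ge_0 by blast

text \<open>Each squared step is at most a multiple of a decrement of the convergent energy.\<close>
lemma step_tendsto_0: "(\<lambda>k. norm (x k - x (k - 1))) \<longlonglongrightarrow> 0"
proof -
  obtain l where l: "energy \<longlonglongrightarrow> l" by (rule energy_convergent)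
  have "(\<lambda>k. (energy k - energy (Suc k)) / descent_const) \<longlonglongrightarrow> (l - l) / descent_const"
    using descent_const_pos by (intro tendsto_intros l LIMSEQ_Suc[OF l]) auto
  then have lim: "(\<lambda>k. (energy k - energy (Suc k)) / descent_const) \<longlonglongrightarrow> 0"
    by simp
  have "(\<lambda>k. (norm (x k - x (k - 1)))\<^sup>2) \<longlonglongrightarrow> 0"
  proof (rule tendsto_sandwich[OF _ _ tendsto_const lim])
    show "\<forall>\<^sub>F k in sequentially. (norm (x k - x (k - 1)))\<^sup>2 \<le> (energy k - energy (Suc k)) / descent_const"
      using energy_sufficient_decrease descent_const_pos
      by (intro always_eventually allI) (simp add: pos_le_divide_eq algebra_simps)
  qed auto
  then show ?thesis
    using tendsto_real_sqrt by fastforce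
qed

lemma gap_le: "norm (x (Suc k) - Y k) \<le> norm (x (Suc k) - x k) + norm (x k - x (k - 1))"
proof -
  have "norm (x (Suc k) - Y k) \<le> norm (x (Suc k) - x k) + norm (\<beta> k *\<^sub>R (x k - x (k - 1)))"
    unfolding extrapolation_def by (metis diff_diff_eq norm_triangle_ineq4)
  also have "norm (\<beta> k *\<^sub>R (x k - x (k - 1))) \<le> 1 * norm (x k - x (k - 1))"
    unfolding norm_scaleR using esqm_initial(4,5)[of k] by (intro mult_right_mono) auto
  finally show ?thesis by simp
qed

lemma gap_tendsto_0: "(\<lambda>k. norm (x (Suc k) - Y k)) \<longlonglongrightarrow> 0"
proof (rule tendsto_sandwich[OF _ _ tendsto_const])
  show "(\<lambda>k. norm (x (Suc k) - x k) + norm (x k - x (k - 1))) \<longlonglongrightarrow> 0"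
    using tendsto_add[OF LIMSEQ_Suc[OF step_tendsto_0] step_tendsto_0] by simp
  show "\<forall>\<^sub>F k in sequentially.
      norm (x (Suc k) - Y k) \<le> norm (x (Suc k) - x k) + norm (x k - x (k - 1))"
    by (intro always_eventually allI gap_le)
qed simp

section \<open>Stabilization of the penalty parameter\<close>

lemma dist_in_C: "u \<in> C \<Longrightarrow> v \<in> C \<Longrightarrow> norm (u - v) \<le> diameter C"
  using diameter_bounded_bound[OF compact_imp_bounded[OF C_set(2)]] by (simp add: dist_norm)

text \<open>The penalty parameter increases only if the linearized violation \<open>\<sigma>\<close> at the new iterate is
  positive. Moving from the iterate towards the Slater point by the fraction \<open>\<sigma> / (\<sigma> + \<epsilon>)\<close> reaches
  a point \<open>u\<close> at which the linearized constraints hold, and optimality compared with \<open>u\<close> bounds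
  \<open>\<sigma> + \<epsilon>\<close>. Both terms of the bound become small if the parameter grows and the steps vanish, so
  infinitely many increases contradict \<open>\<epsilon> > 0\<close>.\<close>
lemma penalty_increase_bound:
  assumes xhat: "xhat \<in> C" "\<And>i. i \<in> {1..m} \<Longrightarrow> g i xhat \<le> - \<epsilon>" and "0 < \<epsilon>"
    and inc: "\<theta> (Suc k) \<noteq> \<theta> k"
  shows "\<epsilon> \<le> (P xhat - mhat) / \<theta> k + Lg * diameter C * norm (x (Suc k) - Y k)"
proof -
  define \<sigma> where "\<sigma> = lin_viol k (x (Suc k))"
  define t where "t = \<sigma> / (\<sigma> + \<epsilon>)"
  define u where "u = (1 - t) *\<^sub>R x (Suc k) + t *\<^sub>R xhat"
  have \<sigma>: "0 < \<sigma>"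
    using inc by (auto simp: \<sigma>_def theta_Suc_lin_viol split: if_splits)
  then have t: "0 < t" "t < 1" and t_eq: "\<sigma> = t * (\<sigma> + \<epsilon>)"
    using \<open>0 < \<epsilon>\<close> by (auto simp: t_def)
  have u: "u \<in> C"
    unfolding u_def using C_set(3) xhat(1) x_in_C t by (intro convexD) auto
  have "lin_viol k u \<le> 0"
    unfolding lin_viol_def
  proof (subst max_violation_le_iff[OF m_pos order_refl], intro ballI)
    fix i assume i: "i \<in> {1..m}"
    have "lin (g i) (G i) xhat (Y k) \<le> g i xhat"
      using i g_convex g_gradient by (intro linearization_le_convex) auto
    with xhat(2)[OF i] have hat: "lin (g i) (G i) xhat (Y k) \<le> - \<epsilon>" by linarith
    have "lin (g i) (G i) u (Y k)
        \<le> (1 - t) * lin (g i) (G i) (x (Suc k)) (Y k) + t * lin (g i) (G i) xhat (Y k)"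
      unfolding u_def using convex_onD[OF convex_on_lin, of t] t by auto
    also have "\<dots> \<le> (1 - t) * \<sigma> + t * (- \<epsilon>)"
      using t hat lin_le_lin_viol[OF i, of "x (Suc k)" k]
      by (intro add_mono mult_left_mono) (auto simp: \<sigma>_def)
    also have "\<dots> = 0" using t_eq by (simp add: algebra_simps)
    finally show "lin (g i) (G i) u (Y k) \<le> 0" .
  qed
  moreover have "P (x (Suc k)) / \<theta> k + \<sigma> + Lg * ((Y k - x (Suc k)) \<bullet> (u - x (Suc k)))
      \<le> P u / \<theta> k + lin_viol k u"
    using minimizer_plus_quadratic_subgradient[OF subproblem_convex x_in_C u subproblem_minimizer]
    by (simp add: \<sigma>_def)
  moreover have "P u \<le> (1 - t) * P (x (Suc k)) + t * P xhat"
    unfolding u_def using convex_onD[OF P_convex, of t] t by auto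
  then have "P u / \<theta> k \<le> ((1 - t) * P (x (Suc k)) + t * P xhat) / \<theta> k"
    using theta_pos[of k] by (simp add: divide_right_mono)
  moreover have "((1 - t) * P (x (Suc k)) + t * P xhat) / \<theta> k
      = P (x (Suc k)) / \<theta> k + t * ((P xhat - P (x (Suc k))) / \<theta> k)"
    using theta_pos[of k] by (simp add: field_simps)
  moreover have "u - x (Suc k) = t *\<^sub>R (xhat - x (Suc k))"
    unfolding u_def by (simp add: algebra_simps)
  then have "Lg * ((Y k - x (Suc k)) \<bullet> (u - x (Suc k)))
      = t * (Lg * ((Y k - x (Suc k)) \<bullet> (xhat - x (Suc k))))"
    by simp
  ultimately have "t * (\<sigma> + \<epsilon>)
      \<le> t * ((P xhat - P (x (Suc k))) / \<theta> k - Lg * ((Y k - x (Suc k)) \<bullet> (xhat - x (Suc k))))"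
    using t_eq by (simp add: right_diff_distrib)
  then have "\<sigma> + \<epsilon> \<le> (P xhat - P (x (Suc k))) / \<theta> k - Lg * ((Y k - x (Suc k)) \<bullet> (xhat - x (Suc k)))"
    using t by simp
  moreover have "(P xhat - P (x (Suc k))) / \<theta> k \<le> (P xhat - mhat) / \<theta> k"
    using mhat_le[OF x_in_C] theta_pos[of k] by (simp add: divide_right_mono)
  moreover have "- (Lg * ((Y k - x (Suc k)) \<bullet> (xhat - x (Suc k))))
      \<le> Lg * diameter C * norm (x (Suc k) - Y k)"
  proof -
    have "- ((Y k - x (Suc k)) \<bullet> (xhat - x (Suc k))) = (x (Suc k) - Y k) \<bullet> (xhat - x (Suc k))"
      by (simp add: inner_diff_left)
    also have "\<dots> \<le> norm (x (Suc k) - Y k) * norm (xhat - x (Suc k))"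
      by (rule norm_cauchy_schwarz)
    also have "\<dots> \<le> norm (x (Suc k) - Y k) * diameter C"
      using dist_in_C[OF xhat(1) x_in_C] by (intro mult_left_mono) auto
    finally have "Lg * - ((Y k - x (Suc k)) \<bullet> (xhat - x (Suc k)))
        \<le> Lg * (norm (x (Suc k) - Y k) * diameter C)"
      using Lg_pos by (intro mult_left_mono) auto
    then show ?thesis by (simp add: mult_ac)
  qed
  ultimately show ?thesis using \<sigma> by linarith
qed

lemma theta_eventually_constant: obtains N where "\<And>k. k \<ge> N \<Longrightarrow> \<theta> k = \<theta> N"
proof -
  obtain xhat where xhat: "xhat \<in> C" "\<And>i. i \<in> {1..m} \<Longrightarrow> g i xhat < 0"
    using slater by blast
  define \<epsilon> where "\<epsilon> = - Max ((\<lambda>i. g i xhat) ` {1..m})"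
  have "Max ((\<lambda>i. g i xhat) ` {1..m}) < 0"
    using m_pos xhat(2) by (subst Max_less_iff) auto
  then have \<epsilon>: "0 < \<epsilon>" by (simp add: \<epsilon>_def)
  have slack: "g i xhat \<le> - \<epsilon>" if "i \<in> {1..m}" for i
  proof -
    have "g i xhat \<le> Max ((\<lambda>i. g i xhat) ` {1..m})"
      using that by (intro Max_ge) auto
    then show ?thesis by (simp add: \<epsilon>_def)
  qed
  have "(\<lambda>k. Lg * diameter C * norm (x (Suc k) - Y k)) \<longlonglongrightarrow> 0"
    using gap_tendsto_0 by (rule tendsto_mult_right_zero)
  then have "\<forall>\<^sub>F k in sequentially. Lg * diameter C * norm (x (Suc k) - Y k) < \<epsilon> / 2"
    using \<epsilon> by (intro order_tendstoD) auto
  then obtain K where K: "\<And>k. k \<ge> K \<Longrightarrow> Lg * diameter C * norm (x (Suc k) - Y k) < \<epsilon> / 2"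
    unfolding eventually_sequentially by blast
  have "\<theta> k \<le> 2 * (P xhat - mhat) / \<epsilon>" if "k \<ge> K" "\<theta> (Suc k) \<noteq> \<theta> k" for k
  proof -
    have "\<epsilon> / 2 \<le> (P xhat - mhat) / \<theta> k"
      using penalty_increase_bound[OF xhat(1) slack \<epsilon> that(2)] K[OF that(1)] by linarith
    then show ?thesis
      using theta_pos[of k] \<epsilon> by (simp add: field_simps)
  qed
  moreover have "\<theta> (Suc k) = \<theta> k \<or> \<theta> (Suc k) = \<theta> k + d" for k
    by (simp add: theta_Suc)
  ultimately show ?thesis
    using eventually_constant_if_increases_bounded[OF esqm_initial(3)] that by blast
qed

section \<open>The potential in the limit\<close>

text \<open>Once the parameter is constant, the potential along the run is a continuous function of the two
  iterates, both of which remain in the closed set \<open>C\<close>.\<close>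
lemma energy_limit_on_accumulation_points:
  assumes l: "energy \<longlonglongrightarrow> l"
    and acc: "(u, v, t) \<in> accumulation_points (\<lambda>k. (x (Suc k), x k, \<theta> k))"
  shows "potential P m g C Lg mhat u v t = ereal l"
proof -
  obtain r where r: "strict_mono r" and "((\<lambda>k. (x (Suc k), x k, \<theta> k)) \<circ> r) \<longlonglongrightarrow> (u, v, t)"
    using acc by (auto simp: accumulation_points_def)
  then have lim: "(\<lambda>j. (x (Suc (r j)), x (r j), \<theta> (r j))) \<longlonglongrightarrow> (u, v, t)"
    by (simp add: o_def)
  have u: "(\<lambda>j. x (Suc (r j))) \<longlonglongrightarrow> u" and v: "(\<lambda>j. x (r j)) \<longlonglongrightarrow> v" and t: "(\<lambda>j. \<theta> (r j)) \<longlonglongrightarrow> t"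
    using tendsto_fst[OF lim] tendsto_fst[OF tendsto_snd[OF lim]] tendsto_snd[OF tendsto_snd[OF lim]]
    by simp_all
  obtain N where N: "\<And>k. k \<ge> N \<Longrightarrow> \<theta> k = \<theta> N" using theta_eventually_constant by blast
  have ev: "\<forall>\<^sub>F j in sequentially. N \<le> r j"
    using filterlim_subseq[OF r] by (simp add: filterlim_at_top)
  then have "(\<lambda>j. \<theta> (r j)) \<longlonglongrightarrow> \<theta> N"
    by (intro tendsto_eventually) (auto elim!: eventually_mono dest: N)
  then have t_eq: "t = \<theta> N" using t LIMSEQ_unique by blast
  have "u \<in> C"
    using closed_sequentially[OF compact_imp_closed[OF C_set(2)] _ u] x_in_C by blast
  have "(\<lambda>j. pen (\<theta> N) (x (Suc (r j)))) \<longlonglongrightarrow> pen (\<theta> N) u"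
    using continuous_on_tendsto_compose[OF continuous_on_pen[of UNIV] u] by simp
  then have "(\<lambda>j. pen (\<theta> N) (x (Suc (r j))) + Lg / 2 * (norm (x (Suc (r j)) - x (r j)))\<^sup>2)
      \<longlonglongrightarrow> pen (\<theta> N) u + Lg / 2 * (norm (u - v))\<^sup>2"
    by (intro tendsto_intros u v)
  moreover have "\<forall>\<^sub>F j in sequentially.
      pen (\<theta> N) (x (Suc (r j))) + Lg / 2 * (norm (x (Suc (r j)) - x (r j)))\<^sup>2 = energy (Suc (r j))"
    using ev by eventually_elim (simp add: energy_def N[OF le_SucI])
  ultimately have "(\<lambda>j. energy (Suc (r j))) \<longlonglongrightarrow> pen (\<theta> N) u + Lg / 2 * (norm (u - v))\<^sup>2"
    using tendsto_cong by force
  moreover have "(\<lambda>j. energy (Suc (r j))) \<longlonglongrightarrow> l"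
    using LIMSEQ_subseq_LIMSEQ[OF LIMSEQ_Suc[OF l] r] by (simp add: o_def)
  ultimately have "pen (\<theta> N) u + Lg / 2 * (norm (u - v))\<^sup>2 = l"
    using LIMSEQ_unique by blast
  then show ?thesis
    using potential_eq[OF \<open>u \<in> C\<close> theta_pos, of v N] t_eq by simp
qed

lemma bounded_iterates: "bounded (range (\<lambda>k. (x (Suc k), x k, \<theta> k)))"
proof -
  obtain N where N: "\<And>k. k \<ge> N \<Longrightarrow> \<theta> k = \<theta> N" using theta_eventually_constant by blast
  have "\<theta> k \<in> \<theta> ` {..N}" for k
  proof (cases "k \<le> N")
    case False
    then have "\<theta> k = \<theta> N" using N[of k] by simp
    then show ?thesis by blast
  qed auto
  then have "range (\<lambda>k. (x (Suc k), x k, \<theta> k)) \<subseteq> C \<times> C \<times> \<theta> ` {..N}"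
    using x_in_C by auto
  moreover have "bounded (C \<times> C \<times> \<theta> ` {..N})"
    by (intro bounded_Times compact_imp_bounded C_set(2) finite_imp_bounded) auto
  ultimately show ?thesis by (rule bounded_subset[rotated])
qed

lemma potential_tendsto:
  assumes l: "energy \<longlonglongrightarrow> l"
  shows "(\<lambda>k. potential P m g C Lg mhat (x (Suc k)) (x k) (\<theta> k)) \<longlonglongrightarrow> ereal l"
proof -
  obtain N where N: "\<And>k. k \<ge> N \<Longrightarrow> \<theta> k = \<theta> N" using theta_eventually_constant by blast
  have "\<forall>\<^sub>F k in sequentially.
      ereal (energy (Suc k)) = potential P m g C Lg mhat (x (Suc k)) (x k) (\<theta> k)"
    unfolding eventually_sequentially
  proof (intro exI allI impI)
    fix k assume "N \<le> k"
    then have "\<theta> (Suc k) = \<theta> k" using N[of k] N[of "Suc k"] by simp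
    then show "ereal (energy (Suc k)) = potential P m g C Lg mhat (x (Suc k)) (x k) (\<theta> k)"
      by (simp add: potential_eq[OF x_in_C theta_pos] energy_def)
  qed
  moreover have "(\<lambda>k. ereal (energy (Suc k))) \<longlonglongrightarrow> ereal l"
    using LIMSEQ_Suc[OF l] by simp
  ultimately show ?thesis
    using tendsto_cong by force
qed

section \<open>Linear convergence\<close>

text \<open>In the three-point inequality with \<open>u\<close> a minimizer \<open>w\<close>, the distances from \<open>w\<close> to the new
  iterate and to the extrapolated point differ by at most the vanishing gap. Hence the limit of the
  energy is the minimum of the penalty function, and not merely a critical value.\<close>
lemma energy_tendsto_min:
  assumes N: "\<And>k. k \<ge> N \<Longrightarrow> \<theta> k = \<theta> N"
    and w: "w \<in> C" and min: "\<And>u. u \<in> C \<Longrightarrow> pen (\<theta> N) w \<le> pen (\<theta> N) u"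
  shows "energy \<longlonglongrightarrow> pen (\<theta> N) w"
proof -
  let ?gap = "\<lambda>k. norm (x (Suc k) - Y k)"
  have upper: "pen (\<theta> k) (x (Suc k)) \<le> pen (\<theta> k) w + Lg / 2 * (2 * diameter C * ?gap k + (?gap k)\<^sup>2)" for k
  proof -
    have "norm (w - Y k) \<le> norm (w - x (Suc k)) + ?gap k"
      using norm_triangle_ineq[of "w - x (Suc k)" "x (Suc k) - Y k"] by simp
    then have "(norm (w - Y k))\<^sup>2 \<le> (norm (w - x (Suc k)) + ?gap k)\<^sup>2"
      by (intro power_mono) auto
    also have "\<dots> = (norm (w - x (Suc k)))\<^sup>2 + 2 * norm (w - x (Suc k)) * ?gap k + (?gap k)\<^sup>2"
      by (simp add: power2_sum)
    also have "\<dots> \<le> (norm (w - x (Suc k)))\<^sup>2 + 2 * diameter C * ?gap k + (?gap k)\<^sup>2"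
      using dist_in_C[OF w x_in_C, of "Suc k"]
      by (intro add_mono mult_right_mono order_refl) auto
    finally have "Lg / 2 * (norm (w - Y k))\<^sup>2
        \<le> Lg / 2 * ((norm (w - x (Suc k)))\<^sup>2 + (2 * diameter C * ?gap k + (?gap k)\<^sup>2))"
      using Lg_pos by (intro mult_left_mono) auto
    then have "Lg / 2 * (norm (w - Y k))\<^sup>2
        \<le> Lg / 2 * (norm (w - x (Suc k)))\<^sup>2 + Lg / 2 * (2 * diameter C * ?gap k + (?gap k)\<^sup>2)"
      by (simp only: distrib_left)
    with pen_three_point[OF w, of k] show ?thesis by linarith
  qed
  have "(\<lambda>k. pen (\<theta> N) (x (Suc k))) \<longlonglongrightarrow> pen (\<theta> N) w"
  proof (rule tendsto_sandwich[OF _ _ tendsto_const])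
    show "\<forall>\<^sub>F k in sequentially. pen (\<theta> N) w \<le> pen (\<theta> N) (x (Suc k))"
      using min[OF x_in_C] by simp
    show "\<forall>\<^sub>F k in sequentially. pen (\<theta> N) (x (Suc k))
        \<le> pen (\<theta> N) w + Lg / 2 * (2 * diameter C * ?gap k + (?gap k)\<^sup>2)"
      unfolding eventually_sequentially using upper N by metis
    have "(\<lambda>k. pen (\<theta> N) w + Lg / 2 * (2 * diameter C * ?gap k + (?gap k)\<^sup>2))
        \<longlonglongrightarrow> pen (\<theta> N) w + Lg / 2 * (2 * diameter C * 0 + 0\<^sup>2)"
      by (intro tendsto_intros gap_tendsto_0)
    then show "(\<lambda>k. pen (\<theta> N) w + Lg / 2 * (2 * diameter C * ?gap k + (?gap k)\<^sup>2))
        \<longlonglongrightarrow> pen (\<theta> N) w" by simp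
  qed
  then have "(\<lambda>k. pen (\<theta> N) (x (Suc k)) + Lg / 2 * (norm (x (Suc k) - x (Suc k - 1)))\<^sup>2)
      \<longlonglongrightarrow> pen (\<theta> N) w + Lg / 2 * 0\<^sup>2"
    by (intro tendsto_intros LIMSEQ_Suc[OF step_tendsto_0])
  moreover have "\<forall>\<^sub>F k in sequentially. pen (\<theta> N) (x (Suc k))
      + Lg / 2 * (norm (x (Suc k) - x (Suc k - 1)))\<^sup>2 = energy (Suc k)"
    unfolding eventually_sequentially energy_def using N by (metis le_SucI)
  ultimately have "(\<lambda>k. energy (Suc k)) \<longlonglongrightarrow> pen (\<theta> N) w"
    using tendsto_cong by force
  then show ?thesis by (rule LIMSEQ_imp_Suc)
qed

text \<open>A subgradient at the new iterate itself is not available, because the multipliers of the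
  subproblem belong to constraints active for the linearizations and not for the functions \<open>g\<close>.
  The bound is therefore applied at the proximal point \<open>p\<close> of the new iterate, where
  \<open>Lg (x\<^sub>k\<^sub>+\<^sub>1 - p)\<close> is a subgradient. With \<open>a = \<parallel>p - x\<^sub>k\<^sub>+\<^sub>1\<parallel>\<close> and \<open>b = \<parallel>x\<^sub>k\<^sub>+\<^sub>1 - y\<^sub>k\<parallel>\<close>, optimality of \<open>p\<close>
  gives \<open>Lg a\<^sup>2 \<le> F(x\<^sub>k\<^sub>+\<^sub>1) - F(p)\<close>, and the three-point inequality with \<open>u = p\<close> bounds this difference by
  \<open>Lg/2 ((a + b)\<^sup>2 - a\<^sup>2)\<close>. Together they force \<open>a \<le> 2 b\<close>, so \<open>b\<close> controls the whole gap.\<close>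
lemma pen_gap_le_of_subgradient_bound:
  assumes c: "0 < c"
    and grow: "\<And>z v. z \<in> C \<Longrightarrow> pen (\<theta> k) z < \<mu> + r
       \<Longrightarrow> (\<And>u. u \<in> C \<Longrightarrow> pen (\<theta> k) z + v \<bullet> (u - z) \<le> pen (\<theta> k) u)
       \<Longrightarrow> pen (\<theta> k) z - \<mu> \<le> c * (norm v)\<^sup>2"
    and near: "pen (\<theta> k) (x (Suc k)) < \<mu> + r"
  shows "pen (\<theta> k) (x (Suc k)) - \<mu> \<le> (5 * Lg / 2 + 4 * c * Lg\<^sup>2) * (norm (x (Suc k) - Y k))\<^sup>2"
proof -
  let ?F = "pen (\<theta> k)" and ?x = "x (Suc k)"
  have "continuous_on C (\<lambda>u. ?F u + Lg / 2 * (norm (u - ?x))\<^sup>2)"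
    by (intro continuous_intros continuous_on_pen)
  then obtain p where p: "p \<in> C"
    and p_min: "\<And>u. u \<in> C \<Longrightarrow> ?F p + Lg / 2 * (norm (p - ?x))\<^sup>2 \<le> ?F u + Lg / 2 * (norm (u - ?x))\<^sup>2"
    using continuous_attains_inf[OF C_set(2,1)] by blast
  define a b where "a = norm (p - ?x)" and "b = norm (?x - Y k)"
  have nonneg: "0 \<le> a" "0 \<le> b" by (simp_all add: a_def b_def)
  have "?F p + Lg / 2 * a\<^sup>2 + Lg / 2 * a\<^sup>2 \<le> ?F ?x"
    using minimizer_plus_quadratic_three_point[OF convex_on_pen[OF theta_pos] p x_in_C[of "Suc k"] p_min]
    by (simp add: a_def norm_minus_commute)
  then have lower: "Lg * a\<^sup>2 \<le> ?F ?x - ?F p" by (simp add: field_simps)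
  have "norm (p - Y k) \<le> a + b"
    using norm_triangle_ineq[of "p - ?x" "?x - Y k"] by (simp add: a_def b_def)
  then have "(norm (p - Y k))\<^sup>2 \<le> (a + b)\<^sup>2"
    by (intro power_mono) auto
  then have "Lg / 2 * (norm (p - Y k))\<^sup>2 \<le> Lg / 2 * (a + b)\<^sup>2"
    using Lg_pos by (intro mult_left_mono) auto
  with pen_three_point[OF p, of k] have upper: "?F ?x - ?F p \<le> Lg / 2 * (a + b)\<^sup>2 - Lg / 2 * a\<^sup>2"
    by (simp add: a_def)
  with lower have "Lg * (2 * a\<^sup>2) \<le> Lg * ((a + b)\<^sup>2 - a\<^sup>2)"
    by (simp add: algebra_simps)
  then have ab: "2 * a\<^sup>2 \<le> (a + b)\<^sup>2 - a\<^sup>2"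
    using Lg_pos by simp
  have a_le: "a \<le> 2 * b"
  proof (rule ccontr)
    assume *: "\<not> a \<le> 2 * b"
    then have "0 < a" using nonneg by linarith
    have "2 * b * a \<le> a * a" "b * b \<le> b * a"
      using * nonneg by (intro mult_right_mono mult_left_mono; linarith)+
    moreover have "2 * (a * a) \<le> 2 * (a * b) + b * b"
      using ab by (simp add: power2_eq_square algebra_simps)
    ultimately have "a * a \<le> b * a" by (simp add: algebra_simps)
    then show False using \<open>0 < a\<close> * nonneg by simp
  qed
  have "(a + b)\<^sup>2 - a\<^sup>2 \<le> 5 * b\<^sup>2"
    using mult_right_mono[OF a_le nonneg(2)] by (simp add: power2_eq_square algebra_simps)
  then have "Lg / 2 * ((a + b)\<^sup>2 - a\<^sup>2) \<le> Lg / 2 * (5 * b\<^sup>2)"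
    using Lg_pos by (intro mult_left_mono) auto
  with upper have part1: "?F ?x - ?F p \<le> 5 * Lg / 2 * b\<^sup>2"
    by (simp add: algebra_simps)
  have "?F p - \<mu> \<le> c * (norm (Lg *\<^sub>R (?x - p)))\<^sup>2"
  proof (rule grow[OF p])
    have "0 \<le> Lg * a\<^sup>2" using Lg_pos by simp
    then show "?F p < \<mu> + r" using lower near by linarith
    show "?F p + Lg *\<^sub>R (?x - p) \<bullet> (u - p) \<le> ?F u" if "u \<in> C" for u
      using minimizer_plus_quadratic_subgradient[OF convex_on_pen[OF theta_pos] p that p_min] by simp
  qed
  also have "\<dots> = c * Lg\<^sup>2 * a\<^sup>2"
    by (simp add: a_def norm_minus_commute power_mult_distrib)
  also have "\<dots> \<le> c * Lg\<^sup>2 * (2 * b)\<^sup>2"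
    using c a_le nonneg by (intro mult_left_mono power_mono) auto
  finally have "?F p - \<mu> \<le> 4 * c * Lg\<^sup>2 * b\<^sup>2" by simp
  with part1 show ?thesis by (simp add: b_def algebra_simps)
qed

text \<open>Two consecutive decrements of the energy dominate the two squared steps on the right of the bound,
  so \<open>energy - \<mu>\<close> contracts by \<open>M / (descent_const + M)\<close> over two indices. Steps are bounded by square
  roots of energy gaps; the fourth root in the definition of \<open>\<sigma>\<close> accounts for both effects.\<close>
lemma geometric_convergence_of_energy_bound:
  assumes lim: "energy \<longlonglongrightarrow> \<mu>" and M: "0 < M"
    and bound: "\<And>k. k \<ge> K \<Longrightarrow> energy (Suc k) - \<mu>
       \<le> M * ((norm (x (Suc k) - x k))\<^sup>2 + (norm (x k - x (k - 1)))\<^sup>2)"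
  obtains l A \<sigma> where "x \<longlonglongrightarrow> l" "0 < A" "0 < \<sigma>" "\<sigma> < 1"
    "\<And>k. k \<ge> K \<Longrightarrow> norm (x k - l) \<le> A * \<sigma> ^ k"
proof -
  define e where "e k = energy k - \<mu>" for k
  define \<sigma> where "\<sigma> = root 4 (M / (descent_const + M))"
  note dc = descent_const_pos
  have e_ge_0: "0 \<le> e k" for k
    using decseq_ge[OF decseq_energy lim, of k] by (simp add: e_def)
  have descent: "descent_const * (norm (x k - x (k - 1)))\<^sup>2 \<le> e k - e (Suc k)" for k
    using energy_sufficient_decrease[of k] by (simp add: e_def)
  have \<sigma>: "0 < \<sigma>" "\<sigma> < 1"
    using dc M by (auto simp: \<sigma>_def)
  have "\<sigma> ^ 4 = M / (descent_const + M)"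
    unfolding \<sigma>_def using dc M by (intro real_root_pow_pos2) auto
  then have \<sigma>4: "(\<sigma>\<^sup>2)\<^sup>2 = M / (descent_const + M)"
    by (simp flip: power_mult)
  have "e (Suc (Suc k)) \<le> (\<sigma>\<^sup>2)\<^sup>2 * e k" if "k \<ge> K" for k
  proof -
    have "descent_const * e (Suc (Suc k)) \<le> descent_const * e (Suc k)"
      using decseqD[OF decseq_energy, of "Suc k" "Suc (Suc k)"] dc by (simp add: e_def)
    also have "\<dots> \<le> descent_const * (M * ((norm (x (Suc k) - x k))\<^sup>2 + (norm (x k - x (k - 1)))\<^sup>2))"
      using bound[OF that] dc by (simp add: e_def)
    also have "\<dots> = M * (descent_const * (norm (x (Suc k) - x k))\<^sup>2
        + descent_const * (norm (x k - x (k - 1)))\<^sup>2)"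
      by (simp add: algebra_simps)
    also have "\<dots> \<le> M * ((e (Suc k) - e (Suc (Suc k))) + (e k - e (Suc k)))"
      using descent[of k] descent[of "Suc k"] M by (intro mult_left_mono add_mono) auto
    finally have "(descent_const + M) * e (Suc (Suc k)) \<le> M * e k"
      by (simp add: algebra_simps)
    then show ?thesis
      unfolding \<sigma>4 using dc M by (simp add: field_simps)
  qed
  then obtain A where A: "0 < A" "\<And>k. k \<ge> K \<Longrightarrow> e k \<le> A * (\<sigma>\<^sup>2) ^ k"
    using two_step_contraction_geometric[of "\<sigma>\<^sup>2" e K] \<sigma> e_ge_0 by auto
  have "norm (x (Suc k) - x k) \<le> sqrt (A / descent_const) * \<sigma> ^ k" if "k \<ge> K" for k
  proof (rule power2_le_imp_le)
    have "descent_const * (norm (x (Suc k) - x k))\<^sup>2 \<le> e (Suc k)"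
      using descent[of "Suc k"] e_ge_0[of "Suc (Suc k)"] by simp
    also have "\<dots> \<le> e k"
      using decseqD[OF decseq_energy, of k "Suc k"] by (simp add: e_def)
    also have "\<dots> \<le> A * (\<sigma>\<^sup>2) ^ k"
      using A(2)[OF that] .
    finally have "(norm (x (Suc k) - x k))\<^sup>2 \<le> A / descent_const * (\<sigma> ^ k)\<^sup>2"
      using dc by (simp add: field_simps flip: power_mult)
    also have "\<dots> = (sqrt (A / descent_const) * \<sigma> ^ k)\<^sup>2"
      using A(1) dc by (simp add: power_mult_distrib)
    finally show "(norm (x (Suc k) - x k))\<^sup>2 \<le> (sqrt (A / descent_const) * \<sigma> ^ k)\<^sup>2" .
  qed (use A(1) dc \<sigma> in simp)
  then obtain l where l: "x \<longlonglongrightarrow> l"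
    "\<And>k. k \<ge> K \<Longrightarrow> norm (x k - l) \<le> sqrt (A / descent_const) / (1 - \<sigma>) * \<sigma> ^ k"
    using geometric_steps_converge[OF \<sigma>] by blast
  moreover have "0 < sqrt (A / descent_const) / (1 - \<sigma>)"
    using A(1) dc \<sigma> by simp
  ultimately show ?thesis using that \<sigma> by blast
qed

text \<open>The limit is feasible because the linearized constraints hold at every step that does not increase
  the parameter, and the linearization error vanishes in the limit. It minimizes the penalty
  function, which on feasible points is an increasing affine function of the objective.\<close>
lemma limit_is_solution:
  assumes N: "\<And>k. k \<ge> N \<Longrightarrow> \<theta> k = \<theta> N" and l: "x \<longlonglongrightarrow> l"
    and w: "w \<in> C" and min: "\<And>u. u \<in> C \<Longrightarrow> pen (\<theta> N) w \<le> pen (\<theta> N) u"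
  shows "is_arg_min P (\<lambda>z. z \<in> C \<inter> feasible_set m g) l"
proof -
  have l_in: "l \<in> C"
    using closed_sequentially[OF compact_imp_closed[OF C_set(2)] _ l] x_in_C by blast
  have "(\<lambda>k. x (Suc k) - (x (Suc k) - Y k)) \<longlonglongrightarrow> l - 0"
    by (rule tendsto_diff[OF LIMSEQ_Suc[OF l] tendsto_norm_zero_cancel[OF gap_tendsto_0]])
  then have Y: "Y \<longlonglongrightarrow> l" by simp
  have feas: "g i l \<le> 0" if i: "i \<in> {1..m}" for i
  proof -
    have "continuous_on UNIV (g i)"
      using i g_convex by (intro convex_on_continuous) auto
    then have "(\<lambda>k. g i (Y k)) \<longlonglongrightarrow> g i l"
      using Y by (auto intro: continuous_on_tendsto_compose)
    moreover have "continuous_on UNIV (G i)"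
      using i gradient_lipschitz by (blast intro: lipschitz_on_continuous_on)
    then have "(\<lambda>k. G i (Y k)) \<longlonglongrightarrow> G i l"
      using Y by (auto intro: continuous_on_tendsto_compose)
    ultimately have "(\<lambda>k. g i (Y k) + G i (Y k) \<bullet> (x (Suc k) - Y k)) \<longlonglongrightarrow> g i l + G i l \<bullet> (l - l)"
      by (intro tendsto_intros Y LIMSEQ_Suc[OF l])
    moreover have "\<forall>\<^sub>F k in sequentially. g i (Y k) + G i (Y k) \<bullet> (x (Suc k) - Y k) \<le> 0"
      unfolding eventually_sequentially
    proof (intro exI allI impI)
      fix k assume "N \<le> k"
      then have "\<theta> (Suc k) = \<theta> k" using N[of k] N[of "Suc k"] by simp
      then show "g i (Y k) + G i (Y k) \<bullet> (x (Suc k) - Y k) \<le> 0"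
        using esqm_initial(3) i theta_Suc[of k] by (auto simp: lin_def split: if_splits)
    qed
    ultimately have "g i l + G i l \<bullet> (l - l) \<le> 0"
      by (rule tendsto_upperbound) simp
    then show ?thesis by simp
  qed
  have viol_0: "viol u = 0" if "\<forall>i\<in>{1..m}. g i u \<le> 0" for u
    using max_violation_le_iff[OF m_pos order_refl, of g u] that viol_ge_0[of u] by simp
  have "(\<lambda>k. pen (\<theta> N) (x k) + Lg / 2 * (norm (x k - x (k - 1)))\<^sup>2) \<longlonglongrightarrow> pen (\<theta> N) l + Lg / 2 * 0\<^sup>2"
    using continuous_on_tendsto_compose[OF continuous_on_pen[of UNIV "\<theta> N"] l]
    by (intro tendsto_intros step_tendsto_0) auto
  moreover have "\<forall>\<^sub>F k in sequentially.
      pen (\<theta> N) (x k) + Lg / 2 * (norm (x k - x (k - 1)))\<^sup>2 = energy k"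
    unfolding eventually_sequentially energy_def using N by metis
  ultimately have "energy \<longlonglongrightarrow> pen (\<theta> N) l"
    using tendsto_cong by force
  then have "pen (\<theta> N) l = pen (\<theta> N) w"
    using energy_tendsto_min[OF N w min] LIMSEQ_unique by blast
  then have le: "pen (\<theta> N) l \<le> pen (\<theta> N) u" if "u \<in> C" for u
    using min[OF that] by simp
  have "P l \<le> P u" if "u \<in> C" "\<forall>i\<in>{1..m}. g i u \<le> 0" for u
  proof -
    have "(P l - mhat) / \<theta> N \<le> (P u - mhat) / \<theta> N"
      using le[OF that(1)] viol_0[OF that(2)] viol_0[of l] feas by (simp add: pen_def)
    then show ?thesis using theta_pos[of N] by (simp add: divide_le_cancel)
  qed
  then show ?thesis
    using l_in feas by (auto simp: is_arg_min_def feasible_set_def not_less)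
qed

lemma linear_convergence:
  assumes N: "\<And>k. k \<ge> N \<Longrightarrow> \<theta> k = \<theta> N"
    and kl: "kl_function (penalty_fun P m g C mhat (\<theta> N)) (1 / 2)"
  obtains l A \<sigma> k0 where "is_arg_min P (\<lambda>z. z \<in> C \<inter> feasible_set m g) l" "x \<longlonglongrightarrow> l"
    "0 < A" "0 < \<sigma>" "\<sigma> < 1" "\<And>k. k > k0 \<Longrightarrow> norm (x k - l) \<le> A * \<sigma> ^ k"
proof -
  obtain w where w: "w \<in> C" and min: "\<And>u. u \<in> C \<Longrightarrow> pen (\<theta> N) w \<le> pen (\<theta> N) u"
    using continuous_attains_inf[OF C_set(2,1) continuous_on_pen] by blast
  define \<mu> where "\<mu> = pen (\<theta> N) w"
  have lim: "energy \<longlonglongrightarrow> \<mu>"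
    unfolding \<mu>_def by (rule energy_tendsto_min[OF N w min])
  obtain c r where c: "0 < c" and r: "0 < r"
    and grow: "\<And>z v. z \<in> C \<Longrightarrow> pen (\<theta> N) z < \<mu> + r
       \<Longrightarrow> (\<And>u. u \<in> C \<Longrightarrow> pen (\<theta> N) z + v \<bullet> (u - z) \<le> pen (\<theta> N) u)
       \<Longrightarrow> pen (\<theta> N) z - \<mu> \<le> c * (norm v)\<^sup>2"
    using kl_half_uniform[OF kl C_set(2) continuous_on_pen, of "\<theta> N" \<mu>] min
    by (auto simp: penalty_fun_def delta_def pen_def \<mu>_def)
  have "\<forall>\<^sub>F k in sequentially. energy (Suc k) < \<mu> + r"
    using LIMSEQ_Suc[OF lim] r by (intro order_tendstoD) auto
  then obtain K where K: "\<And>k. k \<ge> K \<Longrightarrow> energy (Suc k) < \<mu> + r"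
    unfolding eventually_sequentially by blast
  define B where "B = 5 * Lg / 2 + 4 * c * Lg\<^sup>2"
  have B: "0 < B" unfolding B_def using c Lg_pos by (intro add_pos_pos) auto
  have bound: "energy (Suc k) - \<mu>
      \<le> (2 * B + Lg / 2) * ((norm (x (Suc k) - x k))\<^sup>2 + (norm (x k - x (k - 1)))\<^sup>2)"
    if k: "k \<ge> max N K" for k
  proof -
    define D1 D0 where "D1 = norm (x (Suc k) - x k)" and "D0 = norm (x k - x (k - 1))"
    have \<theta>: "\<theta> k = \<theta> N" "\<theta> (Suc k) = \<theta> N" using k N[of k] N[of "Suc k"] by auto
    have en: "energy (Suc k) = pen (\<theta> k) (x (Suc k)) + Lg / 2 * D1\<^sup>2"
      by (simp add: energy_def \<theta> D1_def)
    have "0 \<le> Lg / 2 * D1\<^sup>2" using Lg_pos by simp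
    then have "pen (\<theta> k) (x (Suc k)) < \<mu> + r"
      using K[of k] k en by simp
    then have "pen (\<theta> k) (x (Suc k)) - \<mu> \<le> B * (norm (x (Suc k) - Y k))\<^sup>2"
      unfolding B_def using grow \<theta>(1) by (intro pen_gap_le_of_subgradient_bound[OF c]) auto
    also have "\<dots> \<le> B * (2 * (D1\<^sup>2 + D0\<^sup>2))"
    proof (intro mult_left_mono)
      have "(norm (x (Suc k) - Y k))\<^sup>2 \<le> (D1 + D0)\<^sup>2"
        unfolding D1_def D0_def by (intro power_mono gap_le) auto
      also have "\<dots> \<le> 2 * (D1\<^sup>2 + D0\<^sup>2)"
        using sum_squares_bound[of D1 D0] by (simp add: power2_sum)
      finally show "(norm (x (Suc k) - Y k))\<^sup>2 \<le> 2 * (D1\<^sup>2 + D0\<^sup>2)" .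
    qed (use B in simp)
    finally have "energy (Suc k) - \<mu> \<le> B * (2 * (D1\<^sup>2 + D0\<^sup>2)) + Lg / 2 * D1\<^sup>2"
      using en by simp
    also have "\<dots> \<le> B * (2 * (D1\<^sup>2 + D0\<^sup>2)) + Lg / 2 * (D1\<^sup>2 + D0\<^sup>2)"
      using Lg_pos by simp
    also have "\<dots> = (2 * B + Lg / 2) * (D1\<^sup>2 + D0\<^sup>2)"
      by (simp add: algebra_simps)
    finally show ?thesis by (simp add: D1_def D0_def)
  qed
  have "0 < 2 * B + Lg / 2" using B Lg_pos by simp
  then obtain l A \<sigma> where l: "x \<longlonglongrightarrow> l" "0 < A" "0 < \<sigma>" "\<sigma> < 1"
    "\<And>k. k \<ge> max N K \<Longrightarrow> norm (x k - l) \<le> A * \<sigma> ^ k"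
    using geometric_convergence_of_energy_bound[OF lim _ bound] by blast
  then show ?thesis
    using limit_is_solution[OF N l(1) w min] that[of l A \<sigma> "max N K"] by auto
qed

end

section \<open>Descent, limit points and convergence rate of the method\<close>

theorem theorem4p5:
  fixes P1 :: "real ^ 'n \<Rightarrow> real"
    and m :: nat
    and g :: "nat \<Rightarrow> real ^ 'n \<Rightarrow> real"
    and G :: "nat \<Rightarrow> real ^ 'n \<Rightarrow> real ^ 'n"
    and C :: "(real ^ 'n) set"
    and L :: "nat \<Rightarrow> real"
    and Lg mhat d :: real
    and \<beta> s \<theta> :: "nat \<Rightarrow> real"
    and x :: "nat \<Rightarrow> real ^ 'n"
  assumes P1_convex: "convex_on UNIV P1"
    and m_pos: "1 \<le> m"
    and g_convex: "\<forall>i\<in>{1..m}. convex_on UNIV (g i)"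
    and g_gradient: "\<forall>i\<in>{1..m}. \<forall>z. GDERIV (g i) z :> (G i z)"
    and L_pos: "\<forall>i\<in>{1..m}. 0 < L i"
    and gradient_lipschitz: "\<forall>i\<in>{1..m}. (L i)-lipschitz_on UNIV (G i)"
    and C_set: "C \<noteq> {}" "compact C" "convex C"
    and slater: "\<exists>xhat\<in>C. \<forall>i\<in>{1..m}. g i xhat < 0"
    and Lg_eq: "Lg = Max (L ` {1..m})"
    and mhat_eq: "mhat = (INF z\<in>C. P1 z)"
    and algorithm: "esqm_e P1 m g G C Lg d \<beta> x s \<theta>"
  defines "E \<equiv> potential P1 m g C Lg mhat"
    and "\<Omega> \<equiv> accumulation_points (\<lambda>k. (x (Suc k), x k, \<theta> k))"
  shows "(\<forall>k\<ge>1. E (x (Suc k)) (x k) (\<theta> (Suc k))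
           \<le> E (x k) (x (k - 1)) (\<theta> k)
             - ereal ((1 - (\<beta> k)\<^sup>2) * Lg / 2 * (norm (x k - x (k - 1)))\<^sup>2)) \<and>
         (\<Omega> \<noteq> {} \<and> compact \<Omega> \<and>
           (\<exists>\<omega>::real. (\<lambda>k. E (x (Suc k)) (x k) (\<theta> k)) \<longlonglongrightarrow> ereal \<omega> \<and>
              (\<forall>(u, v, t)\<in>\<Omega>. E u v t = ereal \<omega>))) \<and>
         (\<exists>N0. (\<forall>k\<ge>N0. \<theta> k = \<theta> N0) \<and>
           (kl_function (penalty_fun P1 m g C mhat (\<theta> N0)) (1 / 2) \<longrightarrow>
              (\<exists>xstar. is_arg_min P1 (\<lambda>z. z \<in> C \<inter> feasible_set m g) xstar \<and> x \<longlonglongrightarrow> xstar \<and>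
                 (\<exists>c0>0. \<exists>\<sigma>. 0 < \<sigma> \<and> \<sigma> < 1 \<and>
                    (\<exists>k0. \<forall>k>k0. norm (x k - xstar) \<le> c0 * \<sigma> ^ k)))))"
proof -
  interpret esqm_iteration P1 m g G C L Lg mhat d \<beta> s \<theta> x
    by unfold_locales fact+
  have i: "\<forall>k\<ge>1. E (x (Suc k)) (x k) (\<theta> (Suc k))
      \<le> E (x k) (x (k - 1)) (\<theta> k)
        - ereal ((1 - (\<beta> k)\<^sup>2) * Lg / 2 * (norm (x k - x (k - 1)))\<^sup>2)"
  proof (intro allI impI)
    fix k
    have "energy (Suc k) \<le> energy k - (1 - (\<beta> k)\<^sup>2) * Lg / 2 * (norm (x k - x (k - 1)))\<^sup>2"
      using energy_Suc_le[of k] energy_decrease[of k] by linarith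
    then show "E (x (Suc k)) (x k) (\<theta> (Suc k))
      \<le> E (x k) (x (k - 1)) (\<theta> k)
        - ereal ((1 - (\<beta> k)\<^sup>2) * Lg / 2 * (norm (x k - x (k - 1)))\<^sup>2)"
      unfolding E_def by (simp add: potential_eq[OF x_in_C theta_pos] energy_def)
  qed
  obtain \<omega> where "energy \<longlonglongrightarrow> \<omega>" by (rule energy_convergent)
  then have ii: "\<exists>\<omega>::real. (\<lambda>k. E (x (Suc k)) (x k) (\<theta> k)) \<longlonglongrightarrow> ereal \<omega> \<and>
      (\<forall>(u, v, t)\<in>\<Omega>. E u v t = ereal \<omega>)"
    unfolding E_def \<Omega>_def
    using potential_tendsto energy_limit_on_accumulation_points by blast
  obtain N where N: "\<And>k. k \<ge> N \<Longrightarrow> \<theta> k = \<theta> N" using theta_eventually_constant by blast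
  have iii: "\<exists>N0. (\<forall>k\<ge>N0. \<theta> k = \<theta> N0) \<and>
      (kl_function (penalty_fun P1 m g C mhat (\<theta> N0)) (1 / 2) \<longrightarrow>
        (\<exists>xstar. is_arg_min P1 (\<lambda>z. z \<in> C \<inter> feasible_set m g) xstar \<and> x \<longlonglongrightarrow> xstar \<and>
          (\<exists>c0>0. \<exists>\<sigma>. 0 < \<sigma> \<and> \<sigma> < 1 \<and> (\<exists>k0. \<forall>k>k0. norm (x k - xstar) \<le> c0 * \<sigma> ^ k))))"
  proof (intro exI[of _ N] conjI allI impI)
    assume "kl_function (penalty_fun P1 m g C mhat (\<theta> N)) (1 / 2)"
    from linear_convergence[OF N this]
    show "\<exists>xstar. is_arg_min P1 (\<lambda>z. z \<in> C \<inter> feasible_set m g) xstar \<and> x \<longlonglongrightarrow> xstar \<and>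
      (\<exists>c0>0. \<exists>\<sigma>. 0 < \<sigma> \<and> \<sigma> < 1 \<and> (\<exists>k0. \<forall>k>k0. norm (x k - xstar) \<le> c0 * \<sigma> ^ k))"
      by metis
  qed (use N in blast)
  show ?thesis
    using i ii iii accumulation_points_bounded[OF bounded_iterates] unfolding \<Omega>_def by blast
qed

end
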